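(* Let $D$ be a skew field with a subfield $K$, let $X$ be a nonempty set, and let $E$ be a $D$-field such that $E$ contains a free field $D_K(\langle X\rangle)$. Let $F$ be a $D$-field and suppose that there exists a specialization from $F$ to $E$ (as $D$-fields) satisfying the following condition on a local homomorphism $\alpha$ representing it: $$\alpha^{-1}(x)\cap C_F(K)\neq\emptyset\quad\text{for every } x\in X,$$ where $C_F(K)$ denotes the centralizer of $K$ in $F$. Then $F$ contains a free field $D_K(\langle X\rangle)$.
   Context: Skew field means division ring; a subfield of a skew field means a sub-division-ring. For a ring $R$, an $R$-ring is a ring $L$ with a ring homomorphism $R\to L$; $R$-ring homomorphisms are ring homomorphisms compatible with the maps from $R$. An $R$-field is an $R$-ring which is a skew field; it is epic if it is generated as a skew field by the image of $R$. A local homomorphism between $R$-fields $K,L$ is an $R$-ring homomorphism $\alpha\colon K_0\to L$ from a subring $K_0\subseteq K$ containing the image of $R$ such that every element of $K_0\setminus\ker\alpha$ is a unit of $K_0$. Two local homomorphisms are equivalent if they agree on some subring, contained in both domains and containing the image of $R$, on which their common restriction is still a local homomorphism. A specialization from $K$ to $L$ is an equivalence class of local homomorphisms. A universal $R$-field is an epic $R$-field $U$ such that for every epic $R$-field $K$ there is a unique specialization from $U$ to $K$; if moreover $R\to U$ is injective, $U$ is called the universal field of fractions of $R$ (it is unique up to isomorphism). For a skew field $D$, a subfield $K$ of $D$ and a set $X$, the free $D_K$-ring $D_K\langle X\rangle$ is the ring generated by $X$ over $D$ subject to the relations $ax=xa$ for all $a\in K$, $x\in X$. It has a universal field of fractions,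 denoted $D_K(\langle X\rangle)$ (the free $D_K$-field on $X$). A $D$-field $E$ contains a free field $D_K(\langle X\rangle)$ if there is a $D$-ring homomorphism $D_K(\langle X\rangle)\to E$ (necessarily injective); $X$ is then identified with its image in $E$. The centralizer of $K$ in the $D$-field $F$ means the centralizer in $F$ of the image of $K$ under $D\to F$. *)

theory Defs
  imports "HOL-Algebra.Subrings" "HOL-Algebra.Weak_Morphisms"
begin

section \<open>Skew fields and rings over a base ring\<close>

definition skew_field :: "'a ring \<Rightarrow> bool" where
  "skew_field L \<longleftrightarrow> ring L \<and> \<one>\<^bsub>L\<^esub> \<noteq> \<zero>\<^bsub>L\<^esub> \<and> Units L = carrier L - {\<zero>\<^bsub>L\<^esub>}"

definition sub_skew_field :: "'a set \<Rightarrow> 'a ring \<Rightarrow> bool" where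
  "sub_skew_field S L \<longleftrightarrow> subring S L \<and> skew_field (L\<lparr>carrier := S\<rparr>)"

definition centralizer :: "'a ring \<Rightarrow> 'a set \<Rightarrow> 'a set" where
  "centralizer L S = {x \<in> carrier L. \<forall>s\<in>S. x \<otimes>\<^bsub>L\<^esub> s = s \<otimes>\<^bsub>L\<^esub> x}"

text \<open>A ring over \<open>R\<close> is a pair of a ring \<open>L\<close> and a structure map \<open>l\<close> from \<open>R\<close> to \<open>L\<close>;
  the values of \<open>l\<close> outside \<open>carrier R\<close> are irrelevant.\<close>

definition over_ring :: "'r ring \<Rightarrow> 'a ring \<Rightarrow> ('r \<Rightarrow> 'a) \<Rightarrow> bool" where
  "over_ring R L l \<longleftrightarrow> ring L \<and> l \<in> ring_hom R L"

definition over_hom ::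
  "'r ring \<Rightarrow> 'a ring \<Rightarrow> ('r \<Rightarrow> 'a) \<Rightarrow> 'b ring \<Rightarrow> ('r \<Rightarrow> 'b) \<Rightarrow> ('a \<Rightarrow> 'b) set" where
  "over_hom R A a B b = {h \<in> ring_hom A B. \<forall>r\<in>carrier R. h (a r) = b r}"

definition over_field :: "'r ring \<Rightarrow> 'a ring \<Rightarrow> ('r \<Rightarrow> 'a) \<Rightarrow> bool" where
  "over_field R L l \<longleftrightarrow> over_ring R L l \<and> skew_field L"

definition epic_field :: "'r ring \<Rightarrow> 'a ring \<Rightarrow> ('r \<Rightarrow> 'a) \<Rightarrow> bool" where
  "epic_field R L l \<longleftrightarrow> over_field R L l \<and>
     \<Inter>{S. sub_skew_field S L \<and> l ` carrier R \<subseteq> S} = carrier L"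


section \<open>Specializations\<close>

text \<open>A local homomorphism is a pair of its domain \<open>K0\<close> and a function \<open>\<alpha>\<close> of which only the
  values on \<open>K0\<close> matter: pairs that differ outside \<open>K0\<close> are identified by \<open>spec_rel\<close>.\<close>

definition local_homs ::
  "'r ring \<Rightarrow> 'a ring \<Rightarrow> ('r \<Rightarrow> 'a) \<Rightarrow> 'b ring \<Rightarrow> ('r \<Rightarrow> 'b) \<Rightarrow> ('a set \<times> ('a \<Rightarrow> 'b)) set" where
  "local_homs R K k L l = {(K0, \<alpha>).
     subring K0 K \<and> k ` carrier R \<subseteq> K0 \<and>
     \<alpha> \<in> over_hom R (K\<lparr>carrier := K0\<rparr>) k L l \<and>
     (\<forall>x \<in> K0 - a_kernel (K\<lparr>carrier := K0\<rparr>) L \<alpha>. x \<in> Units (K\<lparr>carrier := K0\<rparr>))}"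

definition spec_rel ::
  "'r ring \<Rightarrow> 'a ring \<Rightarrow> ('r \<Rightarrow> 'a) \<Rightarrow> 'b ring \<Rightarrow> ('r \<Rightarrow> 'b) \<Rightarrow>
    (('a set \<times> ('a \<Rightarrow> 'b)) \<times> ('a set \<times> ('a \<Rightarrow> 'b))) set" where
  "spec_rel R K k L l = {((A, \<alpha>), (B, \<beta>)).
     (A, \<alpha>) \<in> local_homs R K k L l \<and> (B, \<beta>) \<in> local_homs R K k L l \<and>
     (\<exists>V. V \<subseteq> A \<inter> B \<and> (\<forall>x\<in>V. \<alpha> x = \<beta> x) \<and> (V, \<alpha>) \<in> local_homs R K k L l)}"

definition specializations ::
  "'r ring \<Rightarrow> 'a ring \<Rightarrow> ('r \<Rightarrow> 'a) \<Rightarrow> 'b ring \<Rightarrow> ('r \<Rightarrow> 'b) \<Rightarrow> ('a set \<times> ('a \<Rightarrow> 'b)) set set" where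
  "specializations R K k L l = local_homs R K k L l // spec_rel R K k L l"


section \<open>Universal fields of fractions\<close>

text \<open>An element of an epic \<open>R\<close>-field is the value of a rational expression in elements of
  \<open>R\<close>, so that every epic \<open>R\<close>-field, whatever its type, is isomorphic to one whose carrier
  consists of such expressions. The quantifier over all epic \<open>R\<close>-fields in the definition of a
  universal \<open>R\<close>-field therefore ranges over those; the lemma \<open>universal_field_all_types\<close> below
  confirms that nothing is lost.\<close>

datatype 'r ratexp =
    Const 'r
  | Neg "'r ratexp"
  | Inv "'r ratexp"
  | Add "'r ratexp" "'r ratexp"
  | Mul "'r ratexp" "'r ratexp"

definition universal_field :: "'r ring \<Rightarrow> 'u ring \<Rightarrow> ('r \<Rightarrow> 'u) \<Rightarrow> bool" where
  "universal_field R U u \<longleftrightarrow> epic_field R U u \<and>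
     (\<forall>(K :: 'r ratexp ring) k. epic_field R K k \<longrightarrow> (\<exists>!\<sigma>. \<sigma> \<in> specializations R U u K k))"

definition universal_field_of_fractions :: "'r ring \<Rightarrow> 'u ring \<Rightarrow> ('r \<Rightarrow> 'u) \<Rightarrow> bool" where
  "universal_field_of_fractions R U u \<longleftrightarrow> universal_field R U u \<and> inj_on u (carrier R)"


section \<open>The free ring over a skew field\<close>

text \<open>The free ring on a set \<open>S\<close>, with the integers as coefficients: finitely supported integer
  functions on words over \<open>S\<close>. The product sums over all ways to split a word in two.\<close>

definition free_ring :: "'s set \<Rightarrow> ('s list \<Rightarrow> int) ring" where
  "free_ring S = \<lparr>
     carrier = {f. finite {w. f w \<noteq> 0} \<and> {w. f w \<noteq> 0} \<subseteq> lists S},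
     monoid.mult = (\<lambda>f g w. \<Sum>i\<le>length w. f (take i w) * g (drop i w)),
     monoid.one = (\<lambda>w. if w = [] then 1 else 0),
     ring.zero = (\<lambda>w. 0),
     ring.add = (\<lambda>f g w. f w + g w)\<rparr>"

definition free_ring_gen :: "'s \<Rightarrow> 's list \<Rightarrow> int" where
  "free_ring_gen s = (\<lambda>w. if w = [s] then 1 else 0)"

text \<open>\<open>D\<^sub>K\<langle>X\<rangle>\<close> is presented by generators \<open>Inl a\<close> for \<open>a\<close> in \<open>D\<close> and \<open>Inr x\<close> for \<open>x\<close> in \<open>X\<close>.
  The first three families of relations make the map \<open>a \<mapsto> Inl a\<close> a ring homomorphism.\<close>

definition free_DK_relations ::
  "'d ring \<Rightarrow> 'd set \<Rightarrow> 'x set \<Rightarrow> (('d + 'x) list \<Rightarrow> int) set" where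
  "free_DK_relations D K X =
    (let G = free_ring (carrier D <+> X);
         c = (\<lambda>a. free_ring_gen (Inl a));
         v = (\<lambda>x. free_ring_gen (Inr x))
     in {c (a \<oplus>\<^bsub>D\<^esub> b) \<ominus>\<^bsub>G\<^esub> (c a \<oplus>\<^bsub>G\<^esub> c b) | a b. a \<in> carrier D \<and> b \<in> carrier D}
      \<union> {c (a \<otimes>\<^bsub>D\<^esub> b) \<ominus>\<^bsub>G\<^esub> (c a \<otimes>\<^bsub>G\<^esub> c b) | a b. a \<in> carrier D \<and> b \<in> carrier D}
      \<union> {c \<one>\<^bsub>D\<^esub> \<ominus>\<^bsub>G\<^esub> \<one>\<^bsub>G\<^esub>}
      \<union> {(c a \<otimes>\<^bsub>G\<^esub> v x) \<ominus>\<^bsub>G\<^esub> (v x \<otimes>\<^bsub>G\<^esub> c a) | a x. a \<in> K \<and> x \<in> X})"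

definition free_DK_ideal ::
  "'d ring \<Rightarrow> 'd set \<Rightarrow> 'x set \<Rightarrow> (('d + 'x) list \<Rightarrow> int) set" where
  "free_DK_ideal D K X = Idl\<^bsub>free_ring (carrier D <+> X)\<^esub> (free_DK_relations D K X)"

definition free_DK_ring ::
  "'d ring \<Rightarrow> 'd set \<Rightarrow> 'x set \<Rightarrow> (('d + 'x) list \<Rightarrow> int) set ring" where
  "free_DK_ring D K X = free_ring (carrier D <+> X) Quot free_DK_ideal D K X"

definition free_DK_const ::
  "'d ring \<Rightarrow> 'd set \<Rightarrow> 'x set \<Rightarrow> 'd \<Rightarrow> (('d + 'x) list \<Rightarrow> int) set" where
  "free_DK_const D K X a =
     free_DK_ideal D K X +>\<^bsub>free_ring (carrier D <+> X)\<^esub> free_ring_gen (Inl a)"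

definition free_DK_var ::
  "'d ring \<Rightarrow> 'd set \<Rightarrow> 'x set \<Rightarrow> 'x \<Rightarrow> (('d + 'x) list \<Rightarrow> int) set" where
  "free_DK_var D K X x =
     free_DK_ideal D K X +>\<^bsub>free_ring (carrier D <+> X)\<^esub> free_ring_gen (Inr x)"

text \<open>The free field \<open>D\<^sub>K(\<langle>X\<rangle>)\<close> is determined up to isomorphism only; \<open>free_field D K X U u\<close>
  says that \<open>U\<close>, with the map \<open>u\<close> from \<open>D\<^sub>K\<langle>X\<rangle>\<close>, is one.\<close>

definition free_field ::
  "'d ring \<Rightarrow> 'd set \<Rightarrow> 'x set \<Rightarrow> 'u ring \<Rightarrow> ((('d + 'x) list \<Rightarrow> int) set \<Rightarrow> 'u) \<Rightarrow> bool" where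
  "free_field D K X U u \<longleftrightarrow> universal_field_of_fractions (free_DK_ring D K X) U u"

text \<open>The \<open>D\<close>-ring homomorphisms from the free field \<open>U\<close> to the \<open>D\<close>-field \<open>E\<close>. An element \<open>x\<close> of
  \<open>X\<close> is identified with its image \<open>\<phi> (u (free_DK_var D K X x))\<close> in \<open>E\<close>.\<close>

definition free_field_embeddings ::
  "'d ring \<Rightarrow> 'd set \<Rightarrow> 'x set \<Rightarrow> 'u ring \<Rightarrow> ((('d + 'x) list \<Rightarrow> int) set \<Rightarrow> 'u) \<Rightarrow>
    'e ring \<Rightarrow> ('d \<Rightarrow> 'e) \<Rightarrow> ('u \<Rightarrow> 'e) set" where
  "free_field_embeddings D K X U u E e = over_hom D U (u \<circ> free_DK_const D K X) E e"


section \<open>Consistency of the encoding\<close>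

subsection \<open>Specializations are classes of an equivalence relation\<close>

lemma skew_field_iff:
  "skew_field L \<longleftrightarrow> ring L \<and> \<one>\<^bsub>L\<^esub> \<noteq> \<zero>\<^bsub>L\<^esub> \<and>
     (\<forall>x\<in>carrier L. x \<noteq> \<zero>\<^bsub>L\<^esub> \<longrightarrow>
        (\<exists>y\<in>carrier L. y \<otimes>\<^bsub>L\<^esub> x = \<one>\<^bsub>L\<^esub> \<and> x \<otimes>\<^bsub>L\<^esub> y = \<one>\<^bsub>L\<^esub>))"
proof (cases "ring L \<and> \<one>\<^bsub>L\<^esub> \<noteq> \<zero>\<^bsub>L\<^esub>")
  case True
  then interpret ring L by blast
  have "\<zero>\<^bsub>L\<^esub> \<notin> Units L"
    using True by (auto simp: Units_def)
  then show ?thesis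
    using True by (auto simp: skew_field_def Units_def)
qed (auto simp: skew_field_def)

lemma sub_skew_field_iff:
  assumes "ring L"
  shows "sub_skew_field S L \<longleftrightarrow> subring S L \<and> \<one>\<^bsub>L\<^esub> \<noteq> \<zero>\<^bsub>L\<^esub> \<and>
     (\<forall>x\<in>S. x \<noteq> \<zero>\<^bsub>L\<^esub> \<longrightarrow> (\<exists>y\<in>S. y \<otimes>\<^bsub>L\<^esub> x = \<one>\<^bsub>L\<^esub> \<and> x \<otimes>\<^bsub>L\<^esub> y = \<one>\<^bsub>L\<^esub>))"
  unfolding sub_skew_field_def skew_field_iff
  using ring.subring_is_ring[OF assms] by auto

lemma local_homs_iff:
  "(K0, \<alpha>) \<in> local_homs R K k L l \<longleftrightarrow>
     subring K0 K \<and> k ` carrier R \<subseteq> K0 \<and>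
     (\<forall>x\<in>K0. \<alpha> x \<in> carrier L) \<and>
     (\<forall>x\<in>K0. \<forall>y\<in>K0. \<alpha> (x \<otimes>\<^bsub>K\<^esub> y) = \<alpha> x \<otimes>\<^bsub>L\<^esub> \<alpha> y \<and> \<alpha> (x \<oplus>\<^bsub>K\<^esub> y) = \<alpha> x \<oplus>\<^bsub>L\<^esub> \<alpha> y) \<and>
     \<alpha> \<one>\<^bsub>K\<^esub> = \<one>\<^bsub>L\<^esub> \<and> (\<forall>r\<in>carrier R. \<alpha> (k r) = l r) \<and>
     (\<forall>x\<in>K0. \<alpha> x \<noteq> \<zero>\<^bsub>L\<^esub> \<longrightarrow> (\<exists>y\<in>K0. y \<otimes>\<^bsub>K\<^esub> x = \<one>\<^bsub>K\<^esub> \<and> x \<otimes>\<^bsub>K\<^esub> y = \<one>\<^bsub>K\<^esub>))"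
  unfolding local_homs_def over_hom_def ring_hom_def Units_def a_kernel_def' by auto

lemma local_homs_cong:
  assumes V: "(V, \<alpha>) \<in> local_homs R K k L l" and eq: "\<And>x. x \<in> V \<Longrightarrow> \<alpha> x = \<beta> x"
  shows "(V, \<beta>) \<in> local_homs R K k L l"
proof -
  have sub: "subring V K" "k ` carrier R \<subseteq> V"
    using V by (auto simp: local_homs_iff)
  note cl = subringE(3,6,7)[OF sub(1)]
  have "\<beta> (x \<otimes>\<^bsub>K\<^esub> y) = \<beta> x \<otimes>\<^bsub>L\<^esub> \<beta> y \<and> \<beta> (x \<oplus>\<^bsub>K\<^esub> y) = \<beta> x \<oplus>\<^bsub>L\<^esub> \<beta> y"
    if "x \<in> V" "y \<in> V" for x y
    using V that cl by (simp add: local_homs_iff eq[symmetric])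
  moreover have "\<beta> (k r) = l r" if "r \<in> carrier R" for r
  proof -
    have "k r \<in> V"
      using sub(2) that by blast
    then show ?thesis
      using V that by (simp add: local_homs_iff eq[symmetric])
  qed
  ultimately show ?thesis
    using V cl by (simp add: local_homs_iff eq[symmetric])
qed

lemma local_homs_Int:
  assumes "ring K" "\<one>\<^bsub>L\<^esub> \<noteq> \<zero>\<^bsub>L\<^esub>"
    and V: "(V, \<alpha>) \<in> local_homs R K k L l" and W: "(W, \<alpha>) \<in> local_homs R K k L l"
  shows "(V \<inter> W, \<alpha>) \<in> local_homs R K k L l"
proof -
  interpret K: ring K by fact
  have VW: "subring V K" "subring W K"
    using V W by (auto simp: local_homs_iff)
  have "\<exists>y\<in>V \<inter> W. y \<otimes>\<^bsub>K\<^esub> x = \<one>\<^bsub>K\<^esub> \<and> x \<otimes>\<^bsub>K\<^esub> y = \<one>\<^bsub>K\<^esub>"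
    if x: "x \<in> V \<inter> W" "\<alpha> x \<noteq> \<zero>\<^bsub>L\<^esub>" for x
  proof -
    obtain y where y: "y \<in> V" "y \<otimes>\<^bsub>K\<^esub> x = \<one>\<^bsub>K\<^esub>" "x \<otimes>\<^bsub>K\<^esub> y = \<one>\<^bsub>K\<^esub>"
      using V x unfolding local_homs_iff by blast
    obtain z where z: "z \<in> W" "z \<otimes>\<^bsub>K\<^esub> x = \<one>\<^bsub>K\<^esub>" "x \<otimes>\<^bsub>K\<^esub> z = \<one>\<^bsub>K\<^esub>"
      using W x unfolding local_homs_iff by blast
    have c: "x \<in> carrier K" "y \<in> carrier K" "z \<in> carrier K"
      using x y z subringE(1)[OF VW(1)] subringE(1)[OF VW(2)] by auto
    have "y = z"
      using K.inv_unique[OF y(2) z(3)] c by simp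
    then show ?thesis
      using y z by blast
  qed
  then show ?thesis
    using V W K.subring_inter[OF VW] by (simp add: local_homs_iff)
qed

lemma equiv_spec_rel:
  assumes "ring K" "\<one>\<^bsub>L\<^esub> \<noteq> \<zero>\<^bsub>L\<^esub>"
  shows "equiv (local_homs R K k L l) (spec_rel R K k L l)"
proof (rule equivI)
  show "spec_rel R K k L l \<subseteq> local_homs R K k L l \<times> local_homs R K k L l"
    by (auto simp: spec_rel_def)
  show "refl_on (local_homs R K k L l) (spec_rel R K k L l)"
    by (auto simp: refl_on_def spec_rel_def)
  show "sym (spec_rel R K k L l)"
  proof (rule symI)
    fix p q
    assume "(p, q) \<in> spec_rel R K k L l"
    then obtain A \<alpha> B \<beta> V where pq: "p = (A, \<alpha>)" "q = (B, \<beta>)"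
      and h: "p \<in> local_homs R K k L l" "q \<in> local_homs R K k L l"
        "V \<subseteq> A \<inter> B" "\<forall>x\<in>V. \<alpha> x = \<beta> x" "(V, \<alpha>) \<in> local_homs R K k L l"
      by (auto simp: spec_rel_def)
    have "(V, \<beta>) \<in> local_homs R K k L l"
      using local_homs_cong[OF h(5)] h(4) by blast
    then show "(q, p) \<in> spec_rel R K k L l"
      using h pq by (auto simp: spec_rel_def intro!: exI[of _ V])
  qed
  show "trans (spec_rel R K k L l)"
  proof (rule transI)
    fix p q r
    assume "(p, q) \<in> spec_rel R K k L l" "(q, r) \<in> spec_rel R K k L l"
    then obtain A \<alpha> B \<beta> C \<gamma> V W where pq: "p = (A, \<alpha>)" "q = (B, \<beta>)" "r = (C, \<gamma>)"
      and h: "p \<in> local_homs R K k L l" "r \<in> local_homs R K k L l"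
        "V \<subseteq> A \<inter> B" "\<forall>x\<in>V. \<alpha> x = \<beta> x" "(V, \<alpha>) \<in> local_homs R K k L l"
        "W \<subseteq> B \<inter> C" "\<forall>x\<in>W. \<beta> x = \<gamma> x" "(W, \<beta>) \<in> local_homs R K k L l"
      by (auto simp: spec_rel_def)
    have "(V, \<beta>) \<in> local_homs R K k L l"
      using local_homs_cong[OF h(5)] h(4) by blast
    then have "(V \<inter> W, \<beta>) \<in> local_homs R K k L l"
      by (rule local_homs_Int[OF assms _ h(8)])
    then have "(V \<inter> W, \<alpha>) \<in> local_homs R K k L l"
      by (rule local_homs_cong) (use h(4) in auto)
    then show "(p, r) \<in> spec_rel R K k L l"
      using h pq by (auto simp: spec_rel_def intro!: exI[of _ "V \<inter> W"])
  qed
qed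


subsection \<open>Universal fields are universal for epic fields of every type\<close>

lemma ex1_unique: "\<exists>!x. P x \<Longrightarrow> P a \<Longrightarrow> P b \<Longrightarrow> a = b"
  by blast

lemma ex1_quotient_iff:
  assumes "equiv A r"
  shows "(\<exists>!\<sigma>. \<sigma> \<in> A // r) \<longleftrightarrow> A \<noteq> {} \<and> (\<forall>p\<in>A. \<forall>q\<in>A. (p, q) \<in> r)"
proof
  assume one: "\<exists>!\<sigma>. \<sigma> \<in> A // r"
  then have "A \<noteq> {}"
    using quotient_empty by (metis ex1_implies_ex empty_iff)
  moreover have "(p, q) \<in> r" if "p \<in> A" "q \<in> A" for p q
  proof -
    have "r `` {p} = r `` {q}"
      by (rule ex1_unique[OF one quotientI[OF that(1)] quotientI[OF that(2)]])
    then show ?thesis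
      using eq_equiv_class_iff[OF assms that] by simp
  qed
  ultimately show "A \<noteq> {} \<and> (\<forall>p\<in>A. \<forall>q\<in>A. (p, q) \<in> r)"
    by simp
next
  assume h: "A \<noteq> {} \<and> (\<forall>p\<in>A. \<forall>q\<in>A. (p, q) \<in> r)"
  then obtain p where p: "p \<in> A"
    by auto
  show "\<exists>!\<sigma>. \<sigma> \<in> A // r"
  proof (rule ex1I)
    show "r `` {p} \<in> A // r"
      using p by (rule quotientI)
    show "\<tau> = r `` {p}" if "\<tau> \<in> A // r" for \<tau>
      using that
    proof (rule quotientE)
      fix q
      assume q: "\<tau> = r `` {q}" "q \<in> A"
      then have "(q, p) \<in> r"
        using h p by simp
      then show "\<tau> = r `` {p}"
        using equiv_class_eq[OF assms] q by simp
    qed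
  qed
qed

lemma ring_hom_zero':
  assumes "ring L" "ring L'" "h \<in> ring_hom L L'"
  shows "h \<zero>\<^bsub>L\<^esub> = \<zero>\<^bsub>L'\<^esub>"
  using ring_hom_zero[OF assms(3,1,2)] .

lemma local_homs_comp:
  assumes "ring L" "ring L'" "h \<in> ring_hom L L'" "\<And>r. r \<in> carrier R \<Longrightarrow> h (l r) = l' r"
    and "(K0, \<alpha>) \<in> local_homs R K k L l"
  shows "(K0, h \<circ> \<alpha>) \<in> local_homs R K k L' l'"
proof -
  have V: "subring K0 K" "k ` carrier R \<subseteq> K0" and c: "\<And>x. x \<in> K0 \<Longrightarrow> \<alpha> x \<in> carrier L"
    using assms(5) by (auto simp: local_homs_iff)
  note h = ring_hom_memE[OF assms(3)] ring_hom_zero'[OF assms(1-3)]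
  have "\<alpha> x \<noteq> \<zero>\<^bsub>L\<^esub>" if "h (\<alpha> x) \<noteq> \<zero>\<^bsub>L'\<^esub>" for x
    using that h(5) by metis
  then show ?thesis
    using assms(5) c h(1-4) assms(4) by (simp add: local_homs_iff)
qed

lemma epic_field_image_ring:
  assumes epic: "epic_field R L l" and inj: "inj_on g (carrier L)"
  shows "epic_field R (image_ring g L) (g \<circ> l)"
proof -
  let ?L = "image_ring g L"
  have L: "ring L" "skew_field L" and l: "l \<in> ring_hom R L"
    using epic by (auto simp: epic_field_def over_field_def over_ring_def)
  interpret L: ring L by fact
  interpret L': ring ?L
    using L.inj_imp_image_ring_is_ring[OF inj] .
  have g: "g \<in> ring_hom L ?L"
    using inj_imp_image_ring_iso[OF inj] by (simp add: ring_iso_def)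
  note gh = ring_hom_memE[OF g] ring_hom_zero'[OF L(1) L'.ring_axioms g]
  have g_eq: "g x = g y \<longleftrightarrow> x = y" if "x \<in> carrier L" "y \<in> carrier L" for x y
    using inj that by (auto dest: inj_onD)
  have sk: "\<one>\<^bsub>L\<^esub> \<noteq> \<zero>\<^bsub>L\<^esub>" "\<And>x. x \<in> carrier L \<Longrightarrow> x \<noteq> \<zero>\<^bsub>L\<^esub> \<Longrightarrow>
      \<exists>y\<in>carrier L. y \<otimes>\<^bsub>L\<^esub> x = \<one>\<^bsub>L\<^esub> \<and> x \<otimes>\<^bsub>L\<^esub> y = \<one>\<^bsub>L\<^esub>"
    using L(2) by (auto simp: skew_field_iff)
  have one: "\<one>\<^bsub>?L\<^esub> \<noteq> \<zero>\<^bsub>?L\<^esub>"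
    using sk(1) g_eq gh by (metis L.one_closed L.zero_closed)
  have inv: "\<exists>y\<in>carrier ?L. y \<otimes>\<^bsub>?L\<^esub> x = \<one>\<^bsub>?L\<^esub> \<and> x \<otimes>\<^bsub>?L\<^esub> y = \<one>\<^bsub>?L\<^esub>"
    if x: "x \<in> carrier ?L" "x \<noteq> \<zero>\<^bsub>?L\<^esub>" for x
  proof -
    obtain a where a: "a \<in> carrier L" "x = g a"
      using x by (auto simp: image_ring_carrier)
    then have "a \<noteq> \<zero>\<^bsub>L\<^esub>"
      using x gh by auto
    then obtain b where "b \<in> carrier L" "b \<otimes>\<^bsub>L\<^esub> a = \<one>\<^bsub>L\<^esub>" "a \<otimes>\<^bsub>L\<^esub> b = \<one>\<^bsub>L\<^esub>"
      using sk a by blast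
    then show ?thesis
      using a gh by metis
  qed
  have sub: "carrier ?L \<subseteq> S"
    if S: "sub_skew_field S ?L" "(g \<circ> l) ` carrier R \<subseteq> S" for S
  proof -
    have S1: "subring S ?L"
      "\<And>x. x \<in> S \<Longrightarrow> x \<noteq> \<zero>\<^bsub>?L\<^esub> \<Longrightarrow> \<exists>y\<in>S. y \<otimes>\<^bsub>?L\<^esub> x = \<one>\<^bsub>?L\<^esub> \<and> x \<otimes>\<^bsub>?L\<^esub> y = \<one>\<^bsub>?L\<^esub>"
      using S(1) by (auto simp: sub_skew_field_iff[OF L'.ring_axioms])
    note cl = subringE[OF S1(1)]
    define T where "T = {x \<in> carrier L. g x \<in> S}"
    have neg: "g (\<ominus>\<^bsub>L\<^esub> x) = \<ominus>\<^bsub>?L\<^esub> g x" if "x \<in> carrier L" for x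
    proof -
      have "g (\<ominus>\<^bsub>L\<^esub> x) \<oplus>\<^bsub>?L\<^esub> g x = \<zero>\<^bsub>?L\<^esub>"
        using that gh(3)[of "\<ominus>\<^bsub>L\<^esub> x" x] gh(5) by (simp add: L.l_neg)
      then show ?thesis
        using that gh(1) by (metis L'.minus_equality L.a_inv_closed)
    qed
    have "subring T L"
      by (rule L.subringI) (use cl gh neg in \<open>auto simp: T_def\<close>)
    moreover have "\<exists>y\<in>T. y \<otimes>\<^bsub>L\<^esub> x = \<one>\<^bsub>L\<^esub> \<and> x \<otimes>\<^bsub>L\<^esub> y = \<one>\<^bsub>L\<^esub>"
      if x: "x \<in> T" "x \<noteq> \<zero>\<^bsub>L\<^esub>" for x
    proof -
      have xc: "x \<in> carrier L" "g x \<in> S"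
        using x by (auto simp: T_def)
      obtain y where y: "y \<in> carrier L" "y \<otimes>\<^bsub>L\<^esub> x = \<one>\<^bsub>L\<^esub>" "x \<otimes>\<^bsub>L\<^esub> y = \<one>\<^bsub>L\<^esub>"
        using sk(2)[OF xc(1) x(2)] by blast
      have "g x \<noteq> \<zero>\<^bsub>?L\<^esub>"
        using x xc g_eq gh(5) by (metis L.zero_closed)
      then obtain z where z: "z \<in> S" "z \<otimes>\<^bsub>?L\<^esub> g x = \<one>\<^bsub>?L\<^esub>" "g x \<otimes>\<^bsub>?L\<^esub> z = \<one>\<^bsub>?L\<^esub>"
        using S1(2)[OF xc(2)] by blast
      have "g y \<otimes>\<^bsub>?L\<^esub> g x = \<one>\<^bsub>?L\<^esub>"
        using y xc gh by metis
      then have "g y = z"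
        using L'.inv_unique[of "g y" "g x" z] z y xc gh(1) cl(1) by blast
      then show ?thesis
        using y z by (auto simp: T_def)
    qed
    ultimately have "sub_skew_field T L"
      using sk(1) by (auto simp: sub_skew_field_iff[OF L(1)])
    moreover have "l ` carrier R \<subseteq> T"
      using S(2) ring_hom_memE(1)[OF l] by (auto simp: T_def)
    ultimately have "carrier L \<subseteq> T"
      using epic by (auto simp: epic_field_def)
    then show ?thesis
      by (auto simp: T_def image_ring_carrier)
  qed
  have "skew_field ?L"
    using one inv L'.ring_axioms by (auto simp: skew_field_iff)
  moreover have "sub_skew_field (carrier ?L) ?L"
    using one inv L'.carrier_is_subring by (auto simp: sub_skew_field_iff[OF L'.ring_axioms])
  moreover have "g \<circ> l \<in> ring_hom R ?L"
    using ring_hom_trans[OF l g] .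
  moreover from this have "(g \<circ> l) ` carrier R \<subseteq> carrier ?L"
    by (auto dest: ring_hom_memE(1))
  ultimately show ?thesis
    using sub L'.ring_axioms unfolding epic_field_def over_field_def over_ring_def by blast
qed

primrec ratexp_val :: "'r ring \<Rightarrow> 'a ring \<Rightarrow> ('r \<Rightarrow> 'a) \<Rightarrow> 'r ratexp \<Rightarrow> 'a" where
  "ratexp_val R L l (Const r) = (if r \<in> carrier R then l r else \<zero>\<^bsub>L\<^esub>)"
| "ratexp_val R L l (Neg a) = \<ominus>\<^bsub>L\<^esub> ratexp_val R L l a"
| "ratexp_val R L l (Inv a) =
     (if ratexp_val R L l a = \<zero>\<^bsub>L\<^esub> then \<zero>\<^bsub>L\<^esub> else inv\<^bsub>L\<^esub> ratexp_val R L l a)"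
| "ratexp_val R L l (Add a b) = ratexp_val R L l a \<oplus>\<^bsub>L\<^esub> ratexp_val R L l b"
| "ratexp_val R L l (Mul a b) = ratexp_val R L l a \<otimes>\<^bsub>L\<^esub> ratexp_val R L l b"

lemma epic_field_ratexp:
  assumes "ring R" "epic_field R L l"
  shows "range (ratexp_val R L l) = carrier L"
proof -
  have L: "ring L" "skew_field L" and l: "l \<in> ring_hom R L"
    using assms by (auto simp: epic_field_def over_field_def over_ring_def)
  interpret L: ring L by fact
  let ?v = "ratexp_val R L l"
  have U: "Units L = carrier L - {\<zero>\<^bsub>L\<^esub>}" and one: "\<one>\<^bsub>L\<^esub> \<noteq> \<zero>\<^bsub>L\<^esub>"
    using L(2) by (auto simp: skew_field_def)
  have c: "?v a \<in> carrier L" for a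
    by (induction a) (use U ring_hom_memE(1)[OF l] in auto)
  have "subring (range ?v) L"
  proof (rule L.subringI)
    have "\<one>\<^bsub>L\<^esub> = ?v (Const \<one>\<^bsub>R\<^esub>)"
      using ring_hom_memE(4)[OF l] \<open>ring R\<close> by (simp add: ring.ring_simprules)
    then show "\<one>\<^bsub>L\<^esub> \<in> range ?v"
      using rangeI[of ?v "Const \<one>\<^bsub>R\<^esub>"] by metis
    show "\<ominus>\<^bsub>L\<^esub> x \<in> range ?v" if x: "x \<in> range ?v" for x
    proof -
      obtain a where "x = ?v a"
        using x by (rule rangeE)
      then show ?thesis
        using rangeI[of ?v "Neg a"] by simp
    qed
    show "x \<otimes>\<^bsub>L\<^esub> y \<in> range ?v" "x \<oplus>\<^bsub>L\<^esub> y \<in> range ?v"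
      if xy: "x \<in> range ?v" "y \<in> range ?v" for x y
    proof -
      obtain a where "x = ?v a"
        using xy(1) by (rule rangeE)
      moreover obtain b where "y = ?v b"
        using xy(2) by (rule rangeE)
      ultimately show "x \<otimes>\<^bsub>L\<^esub> y \<in> range ?v" "x \<oplus>\<^bsub>L\<^esub> y \<in> range ?v"
        using rangeI[of ?v "Mul a b"] rangeI[of ?v "Add a b"] by simp_all
    qed
  qed (use c in auto)
  moreover have "\<exists>y\<in>range ?v. y \<otimes>\<^bsub>L\<^esub> x = \<one>\<^bsub>L\<^esub> \<and> x \<otimes>\<^bsub>L\<^esub> y = \<one>\<^bsub>L\<^esub>"
    if "x \<in> range ?v" "x \<noteq> \<zero>\<^bsub>L\<^esub>" for x
  proof -
    obtain a where a: "x = ?v a"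
      using \<open>x \<in> range ?v\<close> by blast
    then have "inv\<^bsub>L\<^esub> x = ?v (Inv a)"
      using that by simp
    moreover have "x \<in> Units L"
      using a c U that by auto
    ultimately show ?thesis
      using L.Units_l_inv L.Units_r_inv rangeI[of ?v "Inv a"] by metis
  qed
  moreover have "l ` carrier R \<subseteq> range ?v"
  proof (rule image_subsetI)
    fix r
    assume "r \<in> carrier R"
    then show "l r \<in> range ?v"
      using rangeI[of ?v "Const r"] by simp
  qed
  ultimately have "range ?v \<in> {S. sub_skew_field S L \<and> l ` carrier R \<subseteq> S}"
    unfolding mem_Collect_eq sub_skew_field_iff[OF L(1)] using one by blast
  then have "carrier L \<subseteq> range ?v"
    using assms(2) Inter_lower[of "range ?v"] unfolding epic_field_def by metis
  then show ?thesis
    using c by auto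
qed

theorem universal_field_all_types:
  fixes R :: "'r ring" and U :: "'u ring" and K :: "'k ring"
  assumes R: "ring R" and univ: "universal_field R U u" and epic: "epic_field R K k"
  shows "\<exists>!\<sigma>. \<sigma> \<in> specializations R U u K k"
proof -
  define g where "g = inv_into UNIV (ratexp_val R K k)"
  have g: "inj_on g (carrier K)"
    unfolding g_def epic_field_ratexp[OF R epic, symmetric] by (rule inj_on_inv_into) simp
  let ?K = "image_ring g K"
  have ring: "ring U" "ring K" "\<one>\<^bsub>K\<^esub> \<noteq> \<zero>\<^bsub>K\<^esub>"
    using univ epic
    by (auto simp: universal_field_def epic_field_def over_field_def over_ring_def skew_field_def)
  have epic': "epic_field R ?K (g \<circ> k)"
    using epic_field_image_ring[OF epic g] .
  then have ring': "ring ?K" "\<one>\<^bsub>?K\<^esub> \<noteq> \<zero>\<^bsub>?K\<^esub>"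
    by (auto simp: epic_field_def over_field_def over_ring_def skew_field_def)
  have iso: "g \<in> ring_iso K ?K"
    using inj_imp_image_ring_iso[OF g] .
  define h where "h = inv_into (carrier K) g"
  have h: "h \<in> ring_hom ?K K"
    using ring_iso_set_sym[OF ring(2) iso] by (simp add: h_def ring_iso_def)
  have hg: "h (g x) = x" if "x \<in> carrier K" for x
    using g that by (simp add: h_def)
  have k: "k r \<in> carrier K" if "r \<in> carrier R" for r
    using epic that
    by (auto simp: epic_field_def over_field_def over_ring_def dest: ring_hom_memE(1))
  have push: "(A, g \<circ> \<alpha>) \<in> local_homs R U u ?K (g \<circ> k)" if "(A, \<alpha>) \<in> local_homs R U u K k" for A \<alpha>
    by (rule local_homs_comp[OF ring(2) ring'(1) _ _ that]) (use iso in \<open>auto simp: ring_iso_def\<close>)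
  have pull: "(A, h \<circ> \<alpha>) \<in> local_homs R U u K k"
    if "(A, \<alpha>) \<in> local_homs R U u ?K (g \<circ> k)" for A \<alpha>
    by (rule local_homs_comp[OF ring'(1) ring(2) h _ that]) (use hg k in auto)
  have "\<exists>!\<sigma>. \<sigma> \<in> specializations R U u ?K (g \<circ> k)"
    using univ epic' by (auto simp: universal_field_def)
  then have ex: "local_homs R U u ?K (g \<circ> k) \<noteq> {}"
    and un: "\<And>p q. p \<in> local_homs R U u ?K (g \<circ> k) \<Longrightarrow> q \<in> local_homs R U u ?K (g \<circ> k) \<Longrightarrow>
      (p, q) \<in> spec_rel R U u ?K (g \<circ> k)"
    unfolding specializations_def ex1_quotient_iff[OF equiv_spec_rel[OF ring(1) ring'(2)]] by auto
  have "local_homs R U u K k \<noteq> {}"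
    using ex pull by fast
  moreover have "(p, q) \<in> spec_rel R U u K k"
    if pq: "p \<in> local_homs R U u K k" "q \<in> local_homs R U u K k" for p q
  proof -
    obtain A \<alpha> B \<beta> where e: "p = (A, \<alpha>)" "q = (B, \<beta>)"
      by (metis surj_pair)
    have "((A, g \<circ> \<alpha>), (B, g \<circ> \<beta>)) \<in> spec_rel R U u ?K (g \<circ> k)"
      using un push pq e by blast
    then obtain V where V: "V \<subseteq> A \<inter> B" "\<And>x. x \<in> V \<Longrightarrow> g (\<alpha> x) = g (\<beta> x)"
      "(V, g \<circ> \<alpha>) \<in> local_homs R U u ?K (g \<circ> k)"
      by (auto simp: spec_rel_def)
    have c: "\<alpha> x \<in> carrier K" "\<beta> x \<in> carrier K" if "x \<in> V" for x
      using pq e V(1) that by (auto simp: local_homs_iff)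
    have "\<alpha> x = \<beta> x" if "x \<in> V" for x
      using V(2)[OF that] c[OF that] g by (auto dest: inj_onD)
    moreover have "(V, \<alpha>) \<in> local_homs R U u K k"
      by (rule local_homs_cong[OF pull[OF V(3)]]) (use c hg in auto)
    ultimately show ?thesis
      using pq e V(1) by (auto simp: spec_rel_def intro!: exI[of _ V])
  qed
  ultimately show ?thesis
    unfolding specializations_def ex1_quotient_iff[OF equiv_spec_rel[OF ring(1,3)]] by blast
qed

subsection \<open>The free ring is a ring\<close>

lemma free_ring_simps:
  "f \<in> carrier (free_ring S) \<longleftrightarrow> finite {w. f w \<noteq> 0} \<and> {w. f w \<noteq> 0} \<subseteq> lists S"
  "f \<otimes>\<^bsub>free_ring S\<^esub> g = (\<lambda>w. \<Sum>i\<le>length w. f (take i w) * g (drop i w))"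
  "\<one>\<^bsub>free_ring S\<^esub> = (\<lambda>w. if w = [] then 1 else 0)"
  "\<zero>\<^bsub>free_ring S\<^esub> = (\<lambda>w. 0)"
  "f \<oplus>\<^bsub>free_ring S\<^esub> g = (\<lambda>w. f w + g w)"
  by (simp_all add: free_ring_def)

lemma free_ring_mult_assoc:
  fixes f g h :: "'s list \<Rightarrow> int"
  shows "(\<Sum>i\<le>length w. (\<Sum>j\<le>length (take i w). f (take j (take i w)) * g (drop j (take i w))) * h (drop i w))
    = (\<Sum>j\<le>length w. f (take j w) * (\<Sum>k\<le>length (drop j w). g (take k (drop j w)) * h (drop k (drop j w))))"
    (is "?lhs = ?rhs")
proof -
  let ?t = "\<lambda>i j. f (take j w) * g (drop j (take i w)) * h (drop i w)"
  have "?lhs = (\<Sum>i\<le>length w. \<Sum>j\<le>i. ?t i j)"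
    by (intro sum.cong) (auto simp: sum_distrib_right min_def)
  also have "\<dots> = (\<Sum>(i, j)\<in>(SIGMA i:{..length w}. {..i}). ?t i j)"
    by (subst sum.Sigma) auto
  also have "\<dots> = (\<Sum>(j, k)\<in>(SIGMA j:{..length w}. {..length w - j}). ?t (j + k) j)"
    by (rule sum.reindex_bij_witness[of _ "\<lambda>(j, k). (j + k, j)" "\<lambda>(i, j). (j, i - j)"]) auto
  also have "\<dots> = (\<Sum>j\<le>length w. \<Sum>k\<le>length w - j. ?t (j + k) j)"
    by (subst sum.Sigma) auto
  also have "\<dots> = ?rhs"
    by (intro sum.cong) (auto simp: sum_distrib_left drop_take add.commute mult.assoc)
  finally show ?thesis .
qed

lemma free_ring_mult_closed:
  assumes "f \<in> carrier (free_ring S)" "g \<in> carrier (free_ring S)"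
  shows "f \<otimes>\<^bsub>free_ring S\<^esub> g \<in> carrier (free_ring S)"
proof -
  let ?P = "{w. f w \<noteq> 0}" and ?Q = "{w. g w \<noteq> 0}"
  have "w \<in> (\<lambda>(u, v). u @ v) ` (?P \<times> ?Q)"
    if w: "(\<Sum>i\<le>length w. f (take i w) * g (drop i w)) \<noteq> 0" for w
  proof -
    obtain i where "f (take i w) * g (drop i w) \<noteq> 0"
      using w by (meson sum.neutral)
    then have "(take i w, drop i w) \<in> ?P \<times> ?Q"
      by auto
    then show ?thesis
      by (rule rev_image_eqI) simp
  qed
  then have "{w. (f \<otimes>\<^bsub>free_ring S\<^esub> g) w \<noteq> 0} \<subseteq> (\<lambda>(u, v). u @ v) ` (?P \<times> ?Q)"
    by (auto simp only: free_ring_simps)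
  moreover have "finite ((\<lambda>(u, v). u @ v) ` (?P \<times> ?Q))"
    using assms by (auto simp: free_ring_simps)
  moreover have "(\<lambda>(u, v). u @ v) ` (?P \<times> ?Q) \<subseteq> lists S"
  proof (rule image_subsetI)
    fix p
    assume "p \<in> ?P \<times> ?Q"
    then have "fst p \<in> lists S" "snd p \<in> lists S"
      using assms unfolding free_ring_simps by auto
    then show "(case p of (u, v) \<Rightarrow> u @ v) \<in> lists S"
      by (simp add: case_prod_beta)
  qed
  ultimately show ?thesis
    using finite_subset unfolding free_ring_simps(1) by (metis (no_types, lifting) subset_trans)
qed

lemma free_ring_ring: "ring (free_ring (S :: 'a set))"
proof (rule ringI)
  show "abelian_group (free_ring S)"
  proof (rule abelian_groupI)
    fix f g
    assume fg: "f \<in> carrier (free_ring S)" "g \<in> carrier (free_ring S)"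
    have "{w. f w + g w \<noteq> 0} \<subseteq> {w. f w \<noteq> 0} \<union> {w. g w \<noteq> 0}"
      by auto
    then show "f \<oplus>\<^bsub>free_ring S\<^esub> g \<in> carrier (free_ring S)"
      using fg unfolding free_ring_simps
      by (metis (no_types, lifting) finite_Un finite_subset le_sup_iff subset_trans)
  next
    fix f
    assume "f \<in> carrier (free_ring S)"
    then have "(\<lambda>w. - f w) \<in> carrier (free_ring S)"
      by (simp add: free_ring_simps)
    then show "\<exists>g\<in>carrier (free_ring S). g \<oplus>\<^bsub>free_ring S\<^esub> f = \<zero>\<^bsub>free_ring S\<^esub>"
      by (rule bexI[rotated]) (simp add: free_ring_simps)
  qed (auto simp: free_ring_simps fun_eq_iff)
  show "monoid (free_ring S)"
  proof (rule monoidI)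
    fix f g h
    show "f \<otimes>\<^bsub>free_ring S\<^esub> g \<otimes>\<^bsub>free_ring S\<^esub> h = f \<otimes>\<^bsub>free_ring S\<^esub> (g \<otimes>\<^bsub>free_ring S\<^esub> h)"
      unfolding free_ring_simps by (rule ext) (rule free_ring_mult_assoc)
  next
    fix f :: "'a list \<Rightarrow> int"
    have "(\<Sum>i\<le>length w. (if take i w = [] then 1 else 0) * f (drop i w)) = f w" for w
    proof -
      have "(\<Sum>i\<le>length w. (if take i w = [] then 1 else 0) * f (drop i w)) = (\<Sum>i\<in>{0}. f (drop i w))"
        by (rule sum.mono_neutral_cong_right) auto
      then show ?thesis
        by simp
    qed
    then show "\<one>\<^bsub>free_ring S\<^esub> \<otimes>\<^bsub>free_ring S\<^esub> f = f"
      by (simp add: free_ring_simps)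
    have "(\<Sum>i\<le>length w. f (take i w) * (if drop i w = [] then 1 else 0)) = f w" for w
    proof -
      have "(\<Sum>i\<le>length w. f (take i w) * (if drop i w = [] then 1 else 0)) = (\<Sum>i\<in>{length w}. f (take i w))"
        by (rule sum.mono_neutral_cong_right) auto
      then show ?thesis
        by simp
    qed
    then show "f \<otimes>\<^bsub>free_ring S\<^esub> \<one>\<^bsub>free_ring S\<^esub> = f"
      by (simp add: free_ring_simps)
  qed (use free_ring_mult_closed[of _ S] in \<open>simp_all add: free_ring_simps(1,3)\<close>)
qed (auto simp: free_ring_simps fun_eq_iff sum.distrib algebra_simps)

lemma free_ring_gen_closed: "s \<in> S \<Longrightarrow> free_ring_gen s \<in> carrier (free_ring S)"
  by (auto simp: free_ring_simps free_ring_gen_def)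


subsection \<open>The free ring over a skew field satisfies its relations\<close>

lemma free_DK_relations_closed:
  assumes "ring D" "K \<subseteq> carrier D"
  shows "free_DK_relations D K X \<subseteq> carrier (free_ring (carrier D <+> X))"
proof -
  interpret D: ring D by fact
  let ?G = "free_ring (carrier D <+> X)"
  interpret G: ring ?G by (rule free_ring_ring)
  have "free_ring_gen (Inl a) \<in> carrier ?G" if "a \<in> carrier D" for a
    using that by (auto intro: free_ring_gen_closed)
  moreover have "free_ring_gen (Inr x) \<in> carrier ?G" if "x \<in> X" for x
    using that by (auto intro: free_ring_gen_closed)
  ultimately show ?thesis
    using assms(2) unfolding free_DK_relations_def Let_def by blast
qed

lemma free_DK_ideal_ideal:
  assumes "ring D" "K \<subseteq> carrier D"
  shows "ideal (free_DK_ideal D K X) (free_ring (carrier D <+> X))"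
  unfolding free_DK_ideal_def
  by (rule ring.genideal_ideal[OF free_ring_ring free_DK_relations_closed[OF assms]])

lemma free_DK_ring_ring:
  assumes "ring D" "K \<subseteq> carrier D"
  shows "ring (free_DK_ring D K X)"
  unfolding free_DK_ring_def by (rule ideal.quotient_is_ring[OF free_DK_ideal_ideal[OF assms]])

lemma free_DK_rel_eq:
  assumes "ring D" "K \<subseteq> carrier D"
    and "p \<in> carrier (free_ring (carrier D <+> X))" "q \<in> carrier (free_ring (carrier D <+> X))"
    and "p \<ominus>\<^bsub>free_ring (carrier D <+> X)\<^esub> q \<in> free_DK_relations D K X"
  shows "free_DK_ideal D K X +>\<^bsub>free_ring (carrier D <+> X)\<^esub> p =
    free_DK_ideal D K X +>\<^bsub>free_ring (carrier D <+> X)\<^esub> q"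
proof -
  interpret ideal "free_DK_ideal D K X" "free_ring (carrier D <+> X)"
    by (rule free_DK_ideal_ideal[OF assms(1,2)])
  have "p \<ominus>\<^bsub>free_ring (carrier D <+> X)\<^esub> q \<in> free_DK_ideal D K X"
    using genideal_self[OF free_DK_relations_closed[OF assms(1,2)]] assms(5)
    unfolding free_DK_ideal_def by blast
  then show ?thesis
    using quotient_eq_iff_same_a_r_cos[OF ideal_axioms assms(3,4)] by simp
qed

lemma free_DK_const_hom:
  assumes "ring D" "K \<subseteq> carrier D"
  shows "free_DK_const D K X \<in> ring_hom D (free_DK_ring D K X)"
proof -
  interpret D: ring D by fact
  let ?G = "free_ring (carrier D <+> X)" and ?I = "free_DK_ideal D K X"
  interpret ideal ?I ?G
    by (rule free_DK_ideal_ideal[OF assms])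
  note q = ring_hom_memE[OF rcos_ring_hom]
  have c: "free_ring_gen (Inl a) \<in> carrier ?G" if "a \<in> carrier D" for a
    using that by (auto intro: free_ring_gen_closed)
  show ?thesis
  proof (rule ring_hom_memI)
    fix a b
    assume ab: "a \<in> carrier D" "b \<in> carrier D"
    have "?I +>\<^bsub>?G\<^esub> free_ring_gen (Inl (a \<otimes>\<^bsub>D\<^esub> b)) =
        ?I +>\<^bsub>?G\<^esub> (free_ring_gen (Inl a) \<otimes>\<^bsub>?G\<^esub> free_ring_gen (Inl b))"
      by (rule free_DK_rel_eq[OF assms])
        (use ab c in \<open>auto simp: free_DK_relations_def Let_def\<close>)
    then show "free_DK_const D K X (a \<otimes>\<^bsub>D\<^esub> b) =
        free_DK_const D K X a \<otimes>\<^bsub>free_DK_ring D K X\<^esub> free_DK_const D K X b"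
      using ab c q(2) by (simp add: free_DK_const_def free_DK_ring_def)
    have "?I +>\<^bsub>?G\<^esub> free_ring_gen (Inl (a \<oplus>\<^bsub>D\<^esub> b)) =
        ?I +>\<^bsub>?G\<^esub> (free_ring_gen (Inl a) \<oplus>\<^bsub>?G\<^esub> free_ring_gen (Inl b))"
      by (rule free_DK_rel_eq[OF assms])
        (use ab c in \<open>auto simp: free_DK_relations_def Let_def\<close>)
    then show "free_DK_const D K X (a \<oplus>\<^bsub>D\<^esub> b) =
        free_DK_const D K X a \<oplus>\<^bsub>free_DK_ring D K X\<^esub> free_DK_const D K X b"
      using ab c q(3) by (simp add: free_DK_const_def free_DK_ring_def)
  next
    have "?I +>\<^bsub>?G\<^esub> free_ring_gen (Inl \<one>\<^bsub>D\<^esub>) = ?I +>\<^bsub>?G\<^esub> \<one>\<^bsub>?G\<^esub>"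
      by (rule free_DK_rel_eq[OF assms]) (use c in \<open>auto simp: free_DK_relations_def Let_def\<close>)
    then show "free_DK_const D K X \<one>\<^bsub>D\<^esub> = \<one>\<^bsub>free_DK_ring D K X\<^esub>"
      using q(4) by (simp add: free_DK_const_def free_DK_ring_def)
  qed (use c q(1) in \<open>simp add: free_DK_const_def free_DK_ring_def\<close>)
qed

lemma free_DK_var_commutes:
  assumes "ring D" "K \<subseteq> carrier D" "a \<in> K" "x \<in> X"
  shows "free_DK_const D K X a \<otimes>\<^bsub>free_DK_ring D K X\<^esub> free_DK_var D K X x =
    free_DK_var D K X x \<otimes>\<^bsub>free_DK_ring D K X\<^esub> free_DK_const D K X a"
proof -
  let ?G = "free_ring (carrier D <+> X)" and ?I = "free_DK_ideal D K X"
  interpret ideal ?I ?G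
    by (rule free_DK_ideal_ideal[OF assms(1,2)])
  have c: "free_ring_gen (Inl a) \<in> carrier ?G" "free_ring_gen (Inr x) \<in> carrier ?G"
    using assms(2-4) by (auto intro: free_ring_gen_closed)
  have "?I +>\<^bsub>?G\<^esub> (free_ring_gen (Inl a) \<otimes>\<^bsub>?G\<^esub> free_ring_gen (Inr x)) =
      ?I +>\<^bsub>?G\<^esub> (free_ring_gen (Inr x) \<otimes>\<^bsub>?G\<^esub> free_ring_gen (Inl a))"
    by (rule free_DK_rel_eq[OF assms(1,2)])
      (use c assms(3,4) in \<open>auto simp: free_DK_relations_def Let_def\<close>)
  then show ?thesis
    using c ring_hom_memE(2)[OF rcos_ring_hom]
    by (simp add: free_DK_const_def free_DK_var_def free_DK_ring_def)
qed

end

theory Submission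
  imports Defs
begin

text \<open>Write \<open>R\<close> for \<open>D\<^sub>K\<langle>X\<rangle>\<close> and \<open>U\<close> for its universal field of fractions, and choose for every \<open>x\<close> in
  \<open>X\<close> a preimage under \<open>\<alpha>\<close> that centralizes \<open>K\<close>. By the universal property of \<open>R\<close>
  (\<open>free_DK_hom_exists\<close>), the map from \<open>D\<close> to \<open>F\<close> extends to a ring homomorphism \<open>h\<close> from \<open>R\<close> to \<open>F\<close>
  that sends each \<open>x\<close> to its chosen preimage; this is where the centralizer condition enters. So \<open>F\<close>
  is an \<open>R\<close>-field. Since \<open>\<alpha> \<circ> h\<close> and the embedding of \<open>R\<close> in \<open>E\<close> agree on generators, \<open>\<alpha>\<close> is a
  local homomorphism of \<open>R\<close>-fields (\<open>local_homs_free_DK\<close>).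

  The skew field \<open>T\<close> that \<open>h\<close> generates in \<open>F\<close> is an epic \<open>R\<close>-field, so universality of \<open>U\<close> gives a
  local homomorphism \<open>\<beta>\<close> from a subring \<open>U\<^sub>0\<close> of \<open>U\<close> to \<open>T\<close>. What remains is to see that \<open>U\<^sub>0\<close> is all
  of \<open>U\<close>, for then \<open>\<beta>\<close> is the wanted embedding. The composite \<open>\<alpha> \<circ> \<beta>\<close> is a local homomorphism from
  \<open>U\<close> to \<open>E\<close>, and so is the embedding \<open>\<phi>\<close>, which is defined everywhere. The elements at which
  \<open>\<alpha> \<circ> \<beta>\<close> is defined and agrees with \<open>\<phi>\<close> form a subring of \<open>U\<close> that contains the image of \<open>R\<close>. It is
  closed under inverses: \<open>\<phi>\<close> is injective, so at a nonzero element of this subring \<open>\<alpha> \<circ> \<beta>\<close> does not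
  vanish, and locality provides the inverse in the domain. As \<open>U\<close> is epic, the subring is \<open>U\<close>. This
  part holds over any ring \<open>R\<close> (\<open>universal_field_lift_hom\<close>).\<close>

section \<open>Sub-skew-fields and epic fields\<close>

lemma skew_field_ring: "skew_field L \<Longrightarrow> ring L"
  by (simp add: skew_field_def)

lemma skew_field_inv:
  assumes "skew_field L" "x \<in> carrier L" "x \<noteq> \<zero>\<^bsub>L\<^esub>"
  shows "inv\<^bsub>L\<^esub> x \<in> carrier L" "inv\<^bsub>L\<^esub> x \<otimes>\<^bsub>L\<^esub> x = \<one>\<^bsub>L\<^esub>" "x \<otimes>\<^bsub>L\<^esub> inv\<^bsub>L\<^esub> x = \<one>\<^bsub>L\<^esub>"
proof -
  interpret ring L
    using assms(1) by (rule skew_field_ring)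
  have "x \<in> Units L"
    using assms by (simp add: skew_field_def)
  then show "inv\<^bsub>L\<^esub> x \<in> carrier L" "inv\<^bsub>L\<^esub> x \<otimes>\<^bsub>L\<^esub> x = \<one>\<^bsub>L\<^esub>" "x \<otimes>\<^bsub>L\<^esub> inv\<^bsub>L\<^esub> x = \<one>\<^bsub>L\<^esub>"
    by simp_all
qed

lemma skew_field_inv_eq:
  assumes "skew_field L" "x \<in> carrier L" "y \<in> carrier L" "y \<otimes>\<^bsub>L\<^esub> x = \<one>\<^bsub>L\<^esub>"
  shows "x \<noteq> \<zero>\<^bsub>L\<^esub>" "y = inv\<^bsub>L\<^esub> x"
proof -
  interpret ring L
    using assms(1) by (rule skew_field_ring)
  have "\<one>\<^bsub>L\<^esub> \<noteq> \<zero>\<^bsub>L\<^esub>"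
    using assms(1) by (simp add: skew_field_def)
  then show "x \<noteq> \<zero>\<^bsub>L\<^esub>"
    using assms(4) r_null[OF assms(3)] by metis
  note i = skew_field_inv[OF assms(1,2) this]
  show "y = inv\<^bsub>L\<^esub> x"
    using inv_unique[OF assms(4) i(3) assms(2,3) i(1)] .
qed

lemma sub_skew_field_inv_iff:
  assumes "skew_field L"
  shows "sub_skew_field S L \<longleftrightarrow> subring S L \<and> (\<forall>x\<in>S. x \<noteq> \<zero>\<^bsub>L\<^esub> \<longrightarrow> inv\<^bsub>L\<^esub> x \<in> S)"
proof -
  have "(\<exists>y\<in>S. y \<otimes>\<^bsub>L\<^esub> x = \<one>\<^bsub>L\<^esub> \<and> x \<otimes>\<^bsub>L\<^esub> y = \<one>\<^bsub>L\<^esub>) \<longleftrightarrow> inv\<^bsub>L\<^esub> x \<in> S"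
    if "subring S L" "x \<in> S" "x \<noteq> \<zero>\<^bsub>L\<^esub>" for x
  proof -
    have S: "S \<subseteq> carrier L"
      using that(1) by (rule subringE(1))
    then have x: "x \<in> carrier L"
      using that(2) by blast
    show ?thesis
    proof
      assume "\<exists>y\<in>S. y \<otimes>\<^bsub>L\<^esub> x = \<one>\<^bsub>L\<^esub> \<and> x \<otimes>\<^bsub>L\<^esub> y = \<one>\<^bsub>L\<^esub>"
      then obtain y where y: "y \<in> S" "y \<otimes>\<^bsub>L\<^esub> x = \<one>\<^bsub>L\<^esub>"
        by blast
      then have "y = inv\<^bsub>L\<^esub> x"
        using skew_field_inv_eq(2)[OF assms x _ y(2)] S by blast
      then show "inv\<^bsub>L\<^esub> x \<in> S"
        using y(1) by simp
    next
      assume "inv\<^bsub>L\<^esub> x \<in> S"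
      then show "\<exists>y\<in>S. y \<otimes>\<^bsub>L\<^esub> x = \<one>\<^bsub>L\<^esub> \<and> x \<otimes>\<^bsub>L\<^esub> y = \<one>\<^bsub>L\<^esub>"
        using skew_field_inv(2,3)[OF assms x that(3)] by (intro bexI conjI)
    qed
  qed
  moreover have "\<one>\<^bsub>L\<^esub> \<noteq> \<zero>\<^bsub>L\<^esub>"
    using assms by (simp add: skew_field_def)
  ultimately show ?thesis
    unfolding sub_skew_field_iff[OF skew_field_ring[OF assms]]
    by (intro conj_cong refl) (simp cong: ball_cong)
qed

lemma sub_skew_field_carrier: "skew_field L \<Longrightarrow> sub_skew_field (carrier L) L"
  using ring.carrier_is_subring[OF skew_field_ring]
  by (simp add: sub_skew_field_inv_iff skew_field_inv(1))

lemma sub_skew_field_Inter: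
  assumes "skew_field L" "\<S> \<noteq> {}" "\<And>S. S \<in> \<S> \<Longrightarrow> sub_skew_field S L"
  shows "sub_skew_field (\<Inter>\<S>) L"
proof -
  have S: "subring S L" "\<And>x. x \<in> S \<Longrightarrow> x \<noteq> \<zero>\<^bsub>L\<^esub> \<Longrightarrow> inv\<^bsub>L\<^esub> x \<in> S" if "S \<in> \<S>" for S
    using assms(3)[OF that] by (simp_all add: sub_skew_field_inv_iff[OF assms(1)])
  have "subring (\<Inter>\<S>) L"
    by (rule ring.subring_Inter[OF skew_field_ring[OF assms(1)] S(1) assms(2)])
  then show ?thesis
    using S(2) by (simp add: sub_skew_field_inv_iff[OF assms(1)])
qed

text \<open>The structure \<open>L\<lparr>carrier := T\<rparr>\<close> inherits the operations of \<open>L\<close> but not its additive inverse, which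
  is defined from the carrier; the proof has to identify the two.\<close>

lemma sub_skew_field_trans:
  assumes "skew_field L" "sub_skew_field T L" "sub_skew_field S (L\<lparr>carrier := T\<rparr>)"
  shows "sub_skew_field S L"
proof -
  interpret L: ring L
    using assms(1) by (rule skew_field_ring)
  have T: "subring T L" "ring (L\<lparr>carrier := T\<rparr>)"
    using assms(2) L.subring_is_ring[of T] by (simp_all add: sub_skew_field_def)
  note S = assms(3)[unfolded sub_skew_field_iff[OF T(2)], simplified]
  have sub: "S \<subseteq> T"
    using S subringE(1)[of S "L\<lparr>carrier := T\<rparr>"] by auto
  have neg: "\<ominus>\<^bsub>L\<^esub> x \<in> S" if "x \<in> S" for x
  proof -
    have "\<ominus>\<^bsub>L\<lparr>carrier := T\<rparr>\<^esub> x \<in> S"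
      using S that subringE(5)[of S "L\<lparr>carrier := T\<rparr>"] by blast
    moreover have "\<ominus>\<^bsub>L\<lparr>carrier := T\<rparr>\<^esub> x = \<ominus>\<^bsub>L\<^esub> x"
    proof -
      interpret T: ring "L\<lparr>carrier := T\<rparr>" by (rule T)
      have "x \<in> T"
        using that sub by blast
      then have "\<ominus>\<^bsub>L\<lparr>carrier := T\<rparr>\<^esub> x \<oplus>\<^bsub>L\<^esub> x = \<zero>\<^bsub>L\<^esub>" "\<ominus>\<^bsub>L\<lparr>carrier := T\<rparr>\<^esub> x \<in> carrier L" "x \<in> carrier L"
        using T.l_neg[of x] T.a_inv_closed[of x] subringE(1)[OF T(1)] by auto
      then show ?thesis
        using L.minus_equality by metis
    qed
    ultimately show ?thesis
      by simp
  qed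
  have "subring S L"
    by (rule L.subringI)
      (use sub neg subringE(1)[OF T(1)] subringE(3,6,7)[OF conjunct1[OF S]] in auto)
  then show ?thesis
    using S by (simp add: sub_skew_field_iff[OF L.ring_axioms])
qed

lemma over_field_contains_epic:
  assumes "over_field R L l"
  obtains T where "sub_skew_field T L" "epic_field R (L\<lparr>carrier := T\<rparr>) l"
proof -
  have L: "skew_field L" and l: "l \<in> ring_hom R L"
    using assms by (auto simp: over_field_def over_ring_def)
  define \<S> where "\<S> = {S. sub_skew_field S L \<and> l ` carrier R \<subseteq> S}"
  define T where "T = \<Inter>\<S>"
  have "carrier L \<in> \<S>"
    using sub_skew_field_carrier[OF L] ring_hom_memE(1)[OF l] by (auto simp: \<S>_def)
  then have T: "sub_skew_field T L"
    unfolding T_def by (intro sub_skew_field_Inter[OF L]) (auto simp: \<S>_def)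
  have lT: "l ` carrier R \<subseteq> T"
    by (auto simp: T_def \<S>_def)
  let ?T = "L\<lparr>carrier := T\<rparr>"
  have sk: "skew_field ?T"
    using T by (simp add: sub_skew_field_def)
  have "l \<in> ring_hom R ?T"
    using l lT by (auto simp: ring_hom_def)
  moreover have "T \<subseteq> S" if "sub_skew_field S ?T" "l ` carrier R \<subseteq> S" for S
    using sub_skew_field_trans[OF L T that(1)] that(2) by (auto simp: T_def \<S>_def)
  moreover have "sub_skew_field T ?T"
    using sub_skew_field_carrier[OF sk] by simp
  ultimately have "epic_field R ?T l"
    unfolding epic_field_def over_field_def over_ring_def
    using sk skew_field_ring[OF sk] lT by auto
  then show ?thesis
    using T that by blast
qed

lemma epic_field_subset:
  assumes "epic_field R L l" "sub_skew_field S L" "l ` carrier R \<subseteq> S"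
  shows "carrier L \<subseteq> S"
  using assms by (auto simp: epic_field_def)


section \<open>Lifting a homomorphism along a specialization\<close>

lemma universal_field_local_hom:
  assumes "ring R" "universal_field R U u" "epic_field R L l"
  obtains U0 \<beta> where "(U0, \<beta>) \<in> local_homs R U u L l"
proof -
  have "\<exists>\<sigma>. \<sigma> \<in> specializations R U u L l"
    using universal_field_all_types[OF assms] by blast
  then show ?thesis
    using that unfolding specializations_def quotient_def by fast
qed

lemma additive_on_subring:
  assumes "ring L" "ring M" "subring S L"
    and c: "\<And>x. x \<in> S \<Longrightarrow> h x \<in> carrier M"
    and add: "\<And>x y. x \<in> S \<Longrightarrow> y \<in> S \<Longrightarrow> h (x \<oplus>\<^bsub>L\<^esub> y) = h x \<oplus>\<^bsub>M\<^esub> h y"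
  shows "h \<zero>\<^bsub>L\<^esub> = \<zero>\<^bsub>M\<^esub>" "x \<in> S \<Longrightarrow> h (\<ominus>\<^bsub>L\<^esub> x) = \<ominus>\<^bsub>M\<^esub> h x"
proof -
  interpret L: ring L by fact
  interpret M: ring M by fact
  note S = subringE[OF assms(3)]
  show z: "h \<zero>\<^bsub>L\<^esub> = \<zero>\<^bsub>M\<^esub>"
    using add[OF S(2) S(2)] c[OF S(2)] M.add.r_cancel_one by (metis L.l_zero L.zero_closed)
  show "h (\<ominus>\<^bsub>L\<^esub> x) = \<ominus>\<^bsub>M\<^esub> h x" if "x \<in> S"
  proof -
    have "x \<in> carrier L"
      using S(1) that by blast
    then have "h (\<ominus>\<^bsub>L\<^esub> x) \<oplus>\<^bsub>M\<^esub> h x = \<zero>\<^bsub>M\<^esub>"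
      using add[OF S(5) that] z L.l_neg that by metis
    then show ?thesis
      using M.minus_equality c S(5) that by metis
  qed
qed

text \<open>By universality there is a local homomorphism \<open>\<beta>\<close> from \<open>U\<close> to the skew field that \<open>h\<close> generates
  in \<open>F\<close>. It is defined on all of \<open>U\<close>: the elements at which \<open>\<alpha> \<circ> \<beta>\<close> is defined and equal to \<open>\<phi>\<close>
  are closed under inverses, because \<open>\<phi>\<close> has no kernel and both \<open>\<alpha>\<close> and \<open>\<beta>\<close> are local, and \<open>U\<close> is
  generated as a skew field by the image of \<open>R\<close>, where the two maps agree.\<close>

theorem universal_field_lift_hom:
  assumes R: "ring R" and univ: "universal_field R U u"
    and E: "ring E" "\<one>\<^bsub>E\<^esub> \<noteq> \<zero>\<^bsub>E\<^esub>" and \<phi>: "\<phi> \<in> ring_hom U E"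
    and F: "over_field R F h"
    and \<alpha>: "(F0, \<alpha>) \<in> local_homs R F h E (\<phi> \<circ> u)"
  shows "\<exists>\<psi>. \<psi> \<in> over_hom R U u F h"
proof -
  have sF: "skew_field F"
    using F by (simp add: over_field_def)
  have epicU: "epic_field R U u" and sU: "skew_field U"
    using univ by (auto simp: universal_field_def epic_field_def over_field_def)
  interpret U: ring U
    using sU by (rule skew_field_ring)
  interpret F: ring F
    using sF by (rule skew_field_ring)
  interpret E: ring E by (rule E(1))
  obtain T where T: "sub_skew_field T F" "epic_field R (F\<lparr>carrier := T\<rparr>) h"
    using over_field_contains_epic[OF F] .
  have TF: "T \<subseteq> carrier F"
    using T(1) subringE(1) by (auto simp: sub_skew_field_def)
  obtain U0 \<beta> where \<beta>: "(U0, \<beta>) \<in> local_homs R U u (F\<lparr>carrier := T\<rparr>) h"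
    using universal_field_local_hom[OF R univ T(2)] .
  note \<beta>' = \<beta>[unfolded local_homs_iff, simplified] and \<alpha>' = \<alpha>[unfolded local_homs_iff, simplified]
  note U0 = subringE[OF conjunct1[OF \<beta>']] and F0 = subringE[OF conjunct1[OF \<alpha>']]
  note \<phi>' = ring_hom_memE[OF \<phi>]
  have \<beta>c: "\<beta> z \<in> carrier F" if "z \<in> U0" for z
    using \<beta>' TF that by blast
  have \<alpha>c: "\<alpha> z \<in> carrier E" if "z \<in> F0" for z
    using \<alpha>' that by blast
  have \<beta>m: "\<beta> (x \<otimes>\<^bsub>U\<^esub> y) = \<beta> x \<otimes>\<^bsub>F\<^esub> \<beta> y" "\<beta> (x \<oplus>\<^bsub>U\<^esub> y) = \<beta> x \<oplus>\<^bsub>F\<^esub> \<beta> y"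
    if "x \<in> U0" "y \<in> U0" for x y
    using \<beta>' that by auto
  have \<alpha>m: "\<alpha> (x \<otimes>\<^bsub>F\<^esub> y) = \<alpha> x \<otimes>\<^bsub>E\<^esub> \<alpha> y" "\<alpha> (x \<oplus>\<^bsub>F\<^esub> y) = \<alpha> x \<oplus>\<^bsub>E\<^esub> \<alpha> y"
    if "x \<in> F0" "y \<in> F0" for x y
    using \<alpha>' that by auto
  have one: "\<beta> \<one>\<^bsub>U\<^esub> = \<one>\<^bsub>F\<^esub>" "\<alpha> \<one>\<^bsub>F\<^esub> = \<one>\<^bsub>E\<^esub>"
    using \<alpha>' \<beta>' by auto
  have \<phi>0: "\<phi> z \<noteq> \<zero>\<^bsub>E\<^esub>" if z: "z \<in> carrier U" "z \<noteq> \<zero>\<^bsub>U\<^esub>" for z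
  proof
    assume "\<phi> z = \<zero>\<^bsub>E\<^esub>"
    note i = skew_field_inv[OF sU z]
    have "\<phi> (inv\<^bsub>U\<^esub> z) \<otimes>\<^bsub>E\<^esub> \<phi> z = \<phi> \<one>\<^bsub>U\<^esub>"
      using \<phi>'(2)[OF i(1) z(1)] i(2) by simp
    then show False
      using \<open>\<phi> z = \<zero>\<^bsub>E\<^esub>\<close> \<phi>'(1)[OF i(1)] \<phi>'(4) E(2) by simp
  qed
  note add_\<beta> = additive_on_subring[OF U.ring_axioms F.ring_axioms conjunct1[OF \<beta>'] \<beta>c \<beta>m(2)]
  note add_\<alpha> = additive_on_subring[OF F.ring_axioms E.ring_axioms conjunct1[OF \<alpha>'] \<alpha>c \<alpha>m(2)]
  note add_\<phi> = additive_on_subring[OF U.ring_axioms E.ring_axioms U.carrier_is_subring \<phi>'(1,3)]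
  \<comment> \<open>The last condition makes \<open>\<alpha> \<circ> \<beta>\<close> nonzero on \<open>W - {0}\<close>, which is what locality needs to provide
    inverses.\<close>
  define W where "W = {z \<in> U0. \<beta> z \<in> F0 \<and> \<alpha> (\<beta> z) = \<phi> z}"
  have "sub_skew_field W U"
    unfolding sub_skew_field_inv_iff[OF sU]
  proof (intro conjI ballI impI)
    have *: "\<phi> \<one>\<^bsub>U\<^esub> = \<one>\<^bsub>E\<^esub>" "\<And>x. x \<in> U0 \<Longrightarrow> x \<in> carrier U"
      using \<phi>' U0(1) by auto
    show "subring W U"
      by (rule U.subringI)
        (auto simp: W_def U0(3,5-7) F0(3,5-7) \<beta>m \<alpha>m \<phi>'(2,3) one * add_\<beta>(2) add_\<alpha>(2) add_\<phi>(2))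
  next
    fix z
    assume z: "z \<in> W" "z \<noteq> \<zero>\<^bsub>U\<^esub>"
    then have zW: "z \<in> U0" "\<beta> z \<in> F0" "\<alpha> (\<beta> z) = \<phi> z" "z \<in> carrier U"
      using U0(1) by (auto simp: W_def)
    note i = skew_field_inv[OF sU zW(4) z(2)]
    have nz: "\<alpha> (\<beta> z) \<noteq> \<zero>\<^bsub>E\<^esub>"
      using \<phi>0[OF zW(4) z(2)] zW(3) by simp
    then have "\<beta> z \<noteq> \<zero>\<^bsub>F\<^esub>"
      using add_\<alpha>(1) by auto
    then obtain y where y: "y \<in> U0" "y \<otimes>\<^bsub>U\<^esub> z = \<one>\<^bsub>U\<^esub>"
      using \<beta>' zW(1) by blast
    obtain b where b: "b \<in> F0" "b \<otimes>\<^bsub>F\<^esub> \<beta> z = \<one>\<^bsub>F\<^esub>"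
      using \<alpha>' zW(2) nz by blast
    have "y = inv\<^bsub>U\<^esub> z"
      using skew_field_inv_eq(2)[OF sU zW(4) _ y(2)] y(1) U0(1) by blast
    moreover have "\<beta> y \<otimes>\<^bsub>F\<^esub> \<beta> z = \<one>\<^bsub>F\<^esub>"
      using \<beta>m(1)[OF y(1) zW(1)] y(2) one(1) by simp
    then have "\<beta> y = b"
      using skew_field_inv_eq(2)[OF sF \<beta>c[OF zW(1)]] \<beta>c[OF y(1)] b F0(1) by blast
    moreover have "\<alpha> b = \<phi> y"
    proof (rule E.inv_unique)
      show "\<alpha> b \<otimes>\<^bsub>E\<^esub> \<phi> z = \<one>\<^bsub>E\<^esub>"
        using \<alpha>m(1)[OF b(1) zW(2)] b(2) one(2) zW(3) by simp
      show "\<phi> z \<otimes>\<^bsub>E\<^esub> \<phi> y = \<one>\<^bsub>E\<^esub>"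
        using \<phi>'(2)[OF zW(4) i(1)] i(3) \<phi>'(4) \<open>y = inv\<^bsub>U\<^esub> z\<close> by simp
    qed (use \<alpha>c[OF b(1)] \<phi>'(1) zW(4) y(1) U0(1) in auto)
    ultimately show "inv\<^bsub>U\<^esub> z \<in> W"
      using y b by (simp add: W_def)
  qed
  moreover have "u ` carrier R \<subseteq> W"
    using \<alpha>' \<beta>' by (auto simp: W_def)
  ultimately have "carrier U \<subseteq> W"
    by (rule epic_field_subset[OF epicU])
  then have "carrier U = U0"
    using U0(1) by (auto simp: W_def)
  then have "\<beta> \<in> over_hom R U u F h"
    using \<beta>' \<beta>c by (auto simp: over_hom_def ring_hom_def)
  then show ?thesis
    by blast
qed


section \<open>The universal property of the free ring\<close>

text \<open>The zero coefficient is allowed, so that \<open>free_monomial w\<close> is additive.\<close>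

definition free_monomial :: "'s list \<Rightarrow> int \<Rightarrow> 's list \<Rightarrow> int" where
  "free_monomial w c = (\<lambda>v. if v = w then c else 0)"

lemma free_ring_gen_eq_monomial: "free_ring_gen s = free_monomial [s] 1"
  by (simp add: free_ring_gen_def free_monomial_def)

lemma free_monomial_closed: "w \<in> lists S \<Longrightarrow> free_monomial w c \<in> carrier (free_ring S)"
  by (auto simp: free_ring_simps free_monomial_def split: if_splits intro: finite_subset[of _ "{w}"])

lemma free_ring_induct [consumes 1, case_names zero monomial add]:
  assumes "f \<in> carrier (free_ring S)"
    and "P (\<lambda>w. 0)"
    and "\<And>w c. w \<in> lists S \<Longrightarrow> P (free_monomial w c)"
    and "\<And>f g. f \<in> carrier (free_ring S) \<Longrightarrow> g \<in> carrier (free_ring S) \<Longrightarrow> P f \<Longrightarrow> P g \<Longrightarrow>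
      P (f \<oplus>\<^bsub>free_ring S\<^esub> g)"
  shows "P f"
proof -
  have "P f" if "finite A" "A \<subseteq> lists S" "{w. f w \<noteq> 0} \<subseteq> A" for A f
    using that
  proof (induction A arbitrary: f rule: finite_induct)
    case empty
    then have "f = (\<lambda>w. 0)"
      by auto
    then show ?case
      using assms(2) by simp
  next
    case (insert w A)
    let ?g = "f(w := 0)"
    have g: "{v. ?g v \<noteq> 0} \<subseteq> A"
      using insert.prems(2) by auto
    have A: "A \<subseteq> lists S"
      using insert.prems(1) by simp
    have "?g \<in> carrier (free_ring S)"
      unfolding free_ring_simps using finite_subset[OF g insert.hyps(1)] subset_trans[OF g A] by blast
    moreover have w: "w \<in> lists S"
      using insert.prems(1) by simp
    moreover have "f = free_monomial w (f w) \<oplus>\<^bsub>free_ring S\<^esub> ?g"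
      by (auto simp: free_ring_simps free_monomial_def)
    ultimately show ?case
      using assms(4)[OF free_monomial_closed[OF w] _ assms(3)[OF w] insert.IH[OF A g]] by metis
  qed
  then show ?thesis
    using assms(1) unfolding free_ring_simps by blast
qed

lemma free_monomial_mult:
  "free_monomial u c \<otimes>\<^bsub>free_ring S\<^esub> g =
    (\<lambda>w. if take (length u) w = u then c * g (drop (length u) w) else 0)"
proof
  fix w
  have "(\<Sum>i\<le>length w. free_monomial u c (take i w) * g (drop i w)) =
      (\<Sum>i\<in>{i. i \<le> length w \<and> take i w = u}. c * g (drop i w))"
    by (rule sum.mono_neutral_cong_right) (auto simp: free_monomial_def)
  also have "{i. i \<le> length w \<and> take i w = u} =
      (if take (length u) w = u then {length u} else {})"
    by (auto dest: arg_cong[of "take _ _" _ length])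
  finally show "(free_monomial u c \<otimes>\<^bsub>free_ring S\<^esub> g) w =
      (if take (length u) w = u then c * g (drop (length u) w) else 0)"
    by (simp add: free_ring_simps)
qed

lemma free_monomial_Cons:
  "free_monomial (s # w) c = free_ring_gen s \<otimes>\<^bsub>free_ring S\<^esub> free_monomial w c"
proof
  show "free_monomial (s # w) c v = (free_ring_gen s \<otimes>\<^bsub>free_ring S\<^esub> free_monomial w c) v" for v
    unfolding free_ring_gen_eq_monomial free_monomial_mult
    by (cases v) (auto simp: free_monomial_def)
qed

text \<open>The coefficients cause the only difficulty: an integer multiple of \<open>1\<close> is reached from \<open>0\<close> by adding
  and subtracting \<open>1\<close>.\<close>

lemma free_ring_generated:
  assumes T: "subring T (free_ring S)" and gen: "\<And>s. s \<in> S \<Longrightarrow> free_ring_gen s \<in> T"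
  shows "T = carrier (free_ring S)"
proof -
  interpret G: ring "free_ring S" by (rule free_ring_ring)
  note T' = subringE[OF T]
  have mono: "free_monomial w c \<in> T" if "w \<in> lists S" for w c
    using that
  proof (induction w)
    case Nil
    have neg: "free_monomial [] (- 1) = \<ominus>\<^bsub>free_ring S\<^esub> \<one>\<^bsub>free_ring S\<^esub>"
      by (rule G.minus_equality[symmetric])
        (auto simp: free_monomial_closed free_monomial_def free_ring_simps)
    show ?case
    proof (induction c rule: int_induct[where k = 0])
      case base
      have "free_monomial [] 0 = \<zero>\<^bsub>free_ring S\<^esub>"
        by (auto simp: free_monomial_def free_ring_simps)
      then show ?case
        using T'(2) by simp
    next
      case (step1 i)
      have "free_monomial [] (i + 1) = free_monomial [] i \<oplus>\<^bsub>free_ring S\<^esub> \<one>\<^bsub>free_ring S\<^esub>"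
        by (auto simp: free_monomial_def free_ring_simps)
      then show ?case
        using T'(3) T'(7) step1(2) by simp
    next
      case (step2 i)
      have "free_monomial [] (i - 1) = free_monomial [] i \<oplus>\<^bsub>free_ring S\<^esub> free_monomial [] (- 1)"
        by (auto simp: free_monomial_def free_ring_simps)
      then show ?case
        using T'(3,5,7) step2(2) neg by simp
    qed
  next
    case (Cons s w)
    then show ?case
      using T'(6) gen free_monomial_Cons by metis
  qed
  have "f \<in> T" if "f \<in> carrier (free_ring S)" for f
    using that
  proof (induction rule: free_ring_induct)
    case zero
    then show ?case
      using T'(2) by (simp add: free_ring_simps)
  qed (use mono T'(7) in auto)
  then show ?thesis
    using T'(1) by blast
qed

definition word_val :: "('a, 'm) ring_scheme \<Rightarrow> ('s \<Rightarrow> 'a) \<Rightarrow> 's list \<Rightarrow> 'a" where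
  "word_val L y w = foldr (\<lambda>s a. y s \<otimes>\<^bsub>L\<^esub> a) w \<one>\<^bsub>L\<^esub>"

definition free_ring_val :: "('a, 'm) ring_scheme \<Rightarrow> ('s \<Rightarrow> 'a) \<Rightarrow> ('s list \<Rightarrow> int) \<Rightarrow> 'a" where
  "free_ring_val L y f = (\<Oplus>\<^bsub>L\<^esub>w\<in>{w. f w \<noteq> 0}. [f w] \<cdot>\<^bsub>L\<^esub> word_val L y w)"

context ring
begin

lemma word_val_closed:
  assumes "y \<in> S \<rightarrow> carrier R" "w \<in> lists S"
  shows "word_val R y w \<in> carrier R"
  using assms(2) by (induction w) (use assms(1) in \<open>auto simp: word_val_def\<close>)

lemma word_val_append:
  assumes "y \<in> S \<rightarrow> carrier R" "v \<in> lists S" "w \<in> lists S"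
  shows "word_val R y (v @ w) = word_val R y v \<otimes> word_val R y w"
  using assms(2)
proof (induction v)
  case Nil
  then show ?case
    using word_val_closed[OF assms(1,3)] by (simp add: word_val_def)
next
  case (Cons s v)
  then have "y s \<in> carrier R" "word_val R y v \<in> carrier R"
    using assms(1) word_val_closed[OF assms(1)] by auto
  then show ?case
    using Cons word_val_closed[OF assms(1,3)] by (simp add: word_val_def m_assoc)
qed

text \<open>Two polynomials have different supports; to add their values, both sums are taken over one common
  finite set of words.\<close>

lemma free_ring_val_superset:
  assumes y: "y \<in> S \<rightarrow> carrier R" and A: "finite A" "A \<subseteq> lists S" "{w. f w \<noteq> 0} \<subseteq> A"
  shows "free_ring_val R y f = (\<Oplus>w\<in>A. [f w] \<cdot> word_val R y w)"
  unfolding free_ring_val_def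
proof (rule add.finprod_mono_neutral_cong_left)
  show "(\<lambda>w. [f w] \<cdot> word_val R y w) \<in> A \<rightarrow> carrier R"
    using subsetD[OF A(2)] word_val_closed[OF y] by (simp del: in_lists_conv_set)
qed (use A in \<open>auto simp: add_pow_def\<close>)

lemma free_ring_val_closed:
  assumes y: "y \<in> S \<rightarrow> carrier R" and f: "f \<in> carrier (free_ring S)"
  shows "free_ring_val R y f \<in> carrier R"
  unfolding free_ring_val_def
  by (rule finsum_closed) (use f word_val_closed[OF y] in \<open>auto simp: free_ring_simps\<close>)

lemma free_ring_val_add:
  assumes y: "y \<in> S \<rightarrow> carrier R" and fg: "f \<in> carrier (free_ring S)" "g \<in> carrier (free_ring S)"
  shows "free_ring_val R y (f \<oplus>\<^bsub>free_ring S\<^esub> g) = free_ring_val R y f \<oplus> free_ring_val R y g"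
proof -
  define A where "A = {w. f w \<noteq> 0} \<union> {w. g w \<noteq> 0}"
  have A: "finite A" "A \<subseteq> lists S"
    using fg by (auto simp: A_def free_ring_simps)
  have c: "word_val R y w \<in> carrier R" if "w \<in> A" for w
    using that A(2) word_val_closed[OF y] by blast
  have "free_ring_val R y (f \<oplus>\<^bsub>free_ring S\<^esub> g) =
      (\<Oplus>w\<in>A. [(f \<oplus>\<^bsub>free_ring S\<^esub> g) w] \<cdot> word_val R y w)"
    by (rule free_ring_val_superset[OF y A]) (auto simp: A_def free_ring_simps)
  also have "\<dots> = (\<Oplus>w\<in>A. [f w] \<cdot> word_val R y w \<oplus> [g w] \<cdot> word_val R y w)"
    by (rule finsum_cong') (use c in \<open>auto simp: free_ring_simps add.int_pow_mult\<close>)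
  also have "\<dots> = (\<Oplus>w\<in>A. [f w] \<cdot> word_val R y w) \<oplus> (\<Oplus>w\<in>A. [g w] \<cdot> word_val R y w)"
    by (rule finsum_addf) (use c in auto)
  also have "\<dots> = free_ring_val R y f \<oplus> free_ring_val R y g"
    using free_ring_val_superset[OF y A, of f] free_ring_val_superset[OF y A, of g]
    by (auto simp: A_def)
  finally show ?thesis .
qed

lemma free_ring_val_monomial:
  assumes y: "y \<in> S \<rightarrow> carrier R" and w: "w \<in> lists S"
  shows "free_ring_val R y (free_monomial w c) = [c] \<cdot> word_val R y w"
proof -
  have "free_ring_val R y (free_monomial w c) = (\<Oplus>v\<in>{w}. [free_monomial w c v] \<cdot> word_val R y v)"
    by (rule free_ring_val_superset[OF y]) (use w in \<open>auto simp: free_monomial_def\<close>)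
  then show ?thesis
    using word_val_closed[OF y w] by (simp add: free_monomial_def)
qed

text \<open>Multiplicativity needs to be checked on left factors that are monomials only, because evaluation is
  additive. There the convolution has no cancellation: prefixing \<open>u\<close> is injective on words, and both
  sides are sums over the support of \<open>g\<close>.\<close>

lemma free_ring_val_monomial_mult:
  assumes y: "y \<in> S \<rightarrow> carrier R" and u: "u \<in> lists S" and g: "g \<in> carrier (free_ring S)"
  shows "free_ring_val R y (free_monomial u c \<otimes>\<^bsub>free_ring S\<^esub> g) =
    ([c] \<cdot> word_val R y u) \<otimes> free_ring_val R y g"
proof -
  define B where "B = {w. g w \<noteq> 0}"
  have B: "finite B" "B \<subseteq> lists S"
    using g by (auto simp: B_def free_ring_simps)
  let ?p = "free_monomial u c \<otimes>\<^bsub>free_ring S\<^esub> g"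
  have cu: "word_val R y u \<in> carrier R"
    using word_val_closed[OF y u] .
  have cB: "word_val R y w \<in> carrier R" if "w \<in> B" for w
    using that B(2) word_val_closed[OF y] by blast
  have val: "[?p (u @ w)] \<cdot> word_val R y (u @ w) =
      ([c] \<cdot> word_val R y u) \<otimes> ([g w] \<cdot> word_val R y w)" if w: "w \<in> B" for w
  proof -
    have "word_val R y (u @ w) = word_val R y u \<otimes> word_val R y w"
      using word_val_append[OF y u] w B(2) by blast
    moreover have "?p (u @ w) = c * g w"
      by (simp add: free_monomial_mult)
    ultimately show ?thesis
      using cu cB[OF w]
      by (simp add: add_pow_ldistr_int add_pow_rdistr_int add.int_pow_pow mult.commute)
  qed
  have "w \<in> (@) u ` B" if "?p w \<noteq> 0" for w
  proof (rule image_eqI)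
    show "w = u @ drop (length u) w" "drop (length u) w \<in> B"
      using that unfolding free_monomial_mult B_def
      by (auto split: if_splits) (metis append_take_drop_id)
  qed
  then have "free_ring_val R y ?p = (\<Oplus>w\<in>(@) u ` B. [?p w] \<cdot> word_val R y w)"
    by (intro free_ring_val_superset[OF y]) (use B u in fastforce)+
  also have "\<dots> = (\<Oplus>w\<in>B. [?p (u @ w)] \<cdot> word_val R y (u @ w))"
  proof (rule finsum_reindex)
    have "u @ w \<in> lists S" if "w \<in> B" for w
      using u subsetD[OF B(2) that] by simp
    then show "(\<lambda>w. [?p w] \<cdot> word_val R y w) \<in> (@) u ` B \<rightarrow> carrier R"
      using word_val_closed[OF y] by (auto simp del: in_lists_conv_set)
  qed (simp add: inj_on_def)
  also have "\<dots> = (\<Oplus>w\<in>B. ([c] \<cdot> word_val R y u) \<otimes> ([g w] \<cdot> word_val R y w))"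
    by (rule finsum_cong') (use val cu cB in auto)
  also have "\<dots> = ([c] \<cdot> word_val R y u) \<otimes> (\<Oplus>w\<in>B. [g w] \<cdot> word_val R y w)"
    by (rule finsum_rdistr[symmetric]) (use B cu cB in auto)
  finally show ?thesis
    by (simp add: free_ring_val_def B_def)
qed

lemma free_ring_val_hom:
  assumes y: "y \<in> S \<rightarrow> carrier R"
  shows "free_ring_val R y \<in> ring_hom (free_ring S) R"
proof -
  interpret G: ring "free_ring S" by (rule free_ring_ring)
  note cl = free_ring_val_closed[OF y] and ad = free_ring_val_add[OF y]
  show ?thesis
  proof (rule ring_hom_memI)
    fix f g
    assume f: "f \<in> carrier (free_ring S)" and g: "g \<in> carrier (free_ring S)"
    show "free_ring_val R y (f \<otimes>\<^bsub>free_ring S\<^esub> g) = free_ring_val R y f \<otimes> free_ring_val R y g"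
      using f
    proof (induction rule: free_ring_induct)
      case zero
      have "(\<lambda>w. 0) = \<zero>\<^bsub>free_ring S\<^esub>"
        by (simp add: free_ring_simps)
      moreover have "free_ring_val R y \<zero>\<^bsub>free_ring S\<^esub> = \<zero>"
        by (simp add: free_ring_val_def free_ring_simps)
      ultimately show ?case
        using g cl[OF g] by simp
    next
      case (monomial w c)
      then show ?case
        using free_ring_val_monomial_mult[OF y _ g] free_ring_val_monomial[OF y] by simp
    next
      case (add f1 f2)
      then show ?case
        using g cl by (simp add: ad G.l_distr l_distr)
    qed
  next
    have "\<one>\<^bsub>free_ring S\<^esub> = free_monomial [] 1"
      by (simp add: free_ring_simps free_monomial_def)
    then show "free_ring_val R y \<one>\<^bsub>free_ring S\<^esub> = \<one>"
      using free_ring_val_monomial[OF y, of "[]" 1] add.int_pow_1 by (simp add: word_val_def)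
  qed (use cl ad in auto)
qed

lemma free_ring_val_gen:
  assumes y: "y \<in> S \<rightarrow> carrier R" and s: "s \<in> S"
  shows "free_ring_val R y (free_ring_gen s) = y s"
proof -
  have "y s \<in> carrier R"
    using y s by blast
  then show ?thesis
    using free_ring_val_monomial[OF y, of "[s]" 1] s add.int_pow_1
    by (simp add: free_ring_gen_eq_monomial word_val_def)
qed

end


section \<open>The universal property of the free ring over a skew field\<close>

lemma quotient_hom_exists:
  assumes I: "ideal I A" and S: "ring S" and h: "h \<in> ring_hom A S"
    and ker: "\<And>x. x \<in> I \<Longrightarrow> h x = \<zero>\<^bsub>S\<^esub>"
  obtains g where "g \<in> ring_hom (A Quot I) S" "\<And>x. x \<in> carrier A \<Longrightarrow> g (I +>\<^bsub>A\<^esub> x) = h x"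
proof -
  interpret ideal I A by (rule I)
  interpret S: ring S by (rule S)
  note h' = ring_hom_memE[OF h] and q = ring_hom_memE[OF rcos_ring_hom]
  have eq: "h x = h x'" if "x \<in> carrier A" "x' \<in> carrier A" "I +>\<^bsub>A\<^esub> x = I +>\<^bsub>A\<^esub> x'" for x x'
  proof -
    have "x \<ominus>\<^bsub>A\<^esub> x' \<in> I"
      using quotient_eq_iff_same_a_r_cos[OF I that(1,2)] that(3) by simp
    moreover have "x = (x \<ominus>\<^bsub>A\<^esub> x') \<oplus>\<^bsub>A\<^esub> x'"
      using that(1,2) by (simp add: a_minus_def a_assoc l_neg)
    ultimately show ?thesis
      using ker h'(1,3) that(2) by (metis S.l_zero Icarr)
  qed
  define g where "g C = h (SOME x. x \<in> carrier A \<and> C = I +>\<^bsub>A\<^esub> x)" for C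
  have g: "g (I +>\<^bsub>A\<^esub> x) = h x" if "x \<in> carrier A" for x
  proof -
    let ?x = "SOME x'. x' \<in> carrier A \<and> I +>\<^bsub>A\<^esub> x = I +>\<^bsub>A\<^esub> x'"
    have "?x \<in> carrier A \<and> I +>\<^bsub>A\<^esub> x = I +>\<^bsub>A\<^esub> ?x"
      by (rule someI[where P = "\<lambda>x'. x' \<in> carrier A \<and> I +>\<^bsub>A\<^esub> x = I +>\<^bsub>A\<^esub> x'" and x = x]) (simp add: that)
    then show ?thesis
      using eq[of ?x x] that by (simp add: g_def)
  qed
  have rep: "\<exists>x\<in>carrier A. C = I +>\<^bsub>A\<^esub> x" if "C \<in> carrier (A Quot I)" for C
    using that by (auto simp: FactRing_def A_RCOSETS_def')
  have "g \<in> ring_hom (A Quot I) S"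
  proof (rule ring_hom_memI)
    show "g C \<in> carrier S" if "C \<in> carrier (A Quot I)" for C
      using rep[OF that] g h'(1) by auto
    fix C C'
    assume "C \<in> carrier (A Quot I)" "C' \<in> carrier (A Quot I)"
    then obtain x x' where x: "x \<in> carrier A" "C = I +>\<^bsub>A\<^esub> x" "x' \<in> carrier A" "C' = I +>\<^bsub>A\<^esub> x'"
      using rep by meson
    show "g (C \<otimes>\<^bsub>A Quot I\<^esub> C') = g C \<otimes>\<^bsub>S\<^esub> g C'"
      unfolding x(2,4) q(2)[OF x(1,3), symmetric] using g h'(2) x by simp
    show "g (C \<oplus>\<^bsub>A Quot I\<^esub> C') = g C \<oplus>\<^bsub>S\<^esub> g C'"
      unfolding x(2,4) q(3)[OF x(1,3), symmetric] using g h'(3) x by simp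
  next
    show "g \<one>\<^bsub>A Quot I\<^esub> = \<one>\<^bsub>S\<^esub>"
      using g[OF one_closed] q(4) h'(4) by simp
  qed
  then show ?thesis
    using g that by blast
qed

text \<open>The evaluation of \<open>free_ring (carrier D <+> X)\<close> at \<open>l\<close> and \<open>y\<close> kills the defining relations: the
  first three families because \<open>l\<close> is a ring homomorphism, the last because each \<open>y x\<close> centralizes the
  image of \<open>K\<close>.\<close>

lemma free_DK_hom_exists:
  assumes D: "ring D" and K: "K \<subseteq> carrier D" and L: "ring L" and l: "l \<in> ring_hom D L"
    and y: "\<And>x. x \<in> X \<Longrightarrow> y x \<in> centralizer L (l ` K)"
  obtains h where "h \<in> ring_hom (free_DK_ring D K X) L"
    "\<And>a. a \<in> carrier D \<Longrightarrow> h (free_DK_const D K X a) = l a"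
    "\<And>x. x \<in> X \<Longrightarrow> h (free_DK_var D K X x) = y x"
proof -
  interpret D: ring D by (rule D)
  interpret L: ring L by (rule L)
  let ?G = "free_ring (carrier D <+> X)" and ?I = "free_DK_ideal D K X"
  interpret G: ring ?G by (rule free_ring_ring)
  note l' = ring_hom_memE[OF l]
  have yc: "y x \<in> carrier L" if "x \<in> X" for x
    using y[OF that] by (simp add: centralizer_def)
  define z where "z = case_sum l y"
  have z: "z \<in> carrier D <+> X \<rightarrow> carrier L"
    using l'(1) yc by (auto simp: z_def)
  define p where "p = free_ring_val L z"
  have p: "p \<in> ring_hom ?G L"
    unfolding p_def by (rule L.free_ring_val_hom[OF z])
  note p' = ring_hom_memE[OF p]
  have gen: "free_ring_gen (Inl a) \<in> carrier ?G" "p (free_ring_gen (Inl a)) = l a"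
    if "a \<in> carrier D" for a
    using that L.free_ring_val_gen[OF z, of "Inl a"]
    by (auto simp: z_def p_def intro: free_ring_gen_closed)
  have genx: "free_ring_gen (Inr x) \<in> carrier ?G" "p (free_ring_gen (Inr x)) = y x"
    if "x \<in> X" for x
    using that L.free_ring_val_gen[OF z, of "Inr x"]
    by (auto simp: z_def p_def intro: free_ring_gen_closed)
  interpret p: ring_hom_ring ?G L p
    by (rule ring_hom_ringI2[OF G.ring_axioms L p])
  have pm: "p (a \<ominus>\<^bsub>?G\<^esub> b) = \<zero>\<^bsub>L\<^esub>" if "a \<in> carrier ?G" "b \<in> carrier ?G" "p a = p b" for a b
    using that by (simp add: a_minus_def L.r_neg)
  have Kc: "a \<in> carrier D" if "a \<in> K" for a
    using K that by blast
  have "p r = \<zero>\<^bsub>L\<^esub>" if "r \<in> free_DK_relations D K X" for r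
  proof -
    from that consider
      (add) a b where "a \<in> carrier D" "b \<in> carrier D"
        "r = free_ring_gen (Inl (a \<oplus>\<^bsub>D\<^esub> b)) \<ominus>\<^bsub>?G\<^esub> (free_ring_gen (Inl a) \<oplus>\<^bsub>?G\<^esub> free_ring_gen (Inl b))"
    | (mult) a b where "a \<in> carrier D" "b \<in> carrier D"
        "r = free_ring_gen (Inl (a \<otimes>\<^bsub>D\<^esub> b)) \<ominus>\<^bsub>?G\<^esub> (free_ring_gen (Inl a) \<otimes>\<^bsub>?G\<^esub> free_ring_gen (Inl b))"
    | (one) "r = free_ring_gen (Inl \<one>\<^bsub>D\<^esub>) \<ominus>\<^bsub>?G\<^esub> \<one>\<^bsub>?G\<^esub>"
    | (commute) a x where "a \<in> K" "x \<in> X"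
        "r = (free_ring_gen (Inl a) \<otimes>\<^bsub>?G\<^esub> free_ring_gen (Inr x))
          \<ominus>\<^bsub>?G\<^esub> (free_ring_gen (Inr x) \<otimes>\<^bsub>?G\<^esub> free_ring_gen (Inl a))"
      unfolding free_DK_relations_def Let_def by blast
    then show ?thesis
    proof cases
      case add
      show ?thesis
        unfolding add(3) by (rule pm) (use add(1,2) gen l' in simp_all)
    next
      case mult
      show ?thesis
        unfolding mult(3) by (rule pm) (use mult(1,2) gen l' in simp_all)
    next
      case one
      show ?thesis
        unfolding one by (rule pm) (use gen l' in simp_all)
    next
      case commute
      have "l a \<otimes>\<^bsub>L\<^esub> y x = y x \<otimes>\<^bsub>L\<^esub> l a"
        using y[OF commute(2)] commute(1) by (auto simp: centralizer_def)
      then show ?thesis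
        unfolding commute(3)
        by (intro pm) (use commute(2) gen[OF Kc[OF commute(1)]] genx in simp_all)
    qed
  qed
  then have "free_DK_relations D K X \<subseteq> a_kernel ?G L p"
    using subsetD[OF free_DK_relations_closed[OF D K]] unfolding a_kernel_def' by blast
  then have "?I \<subseteq> a_kernel ?G L p"
    unfolding free_DK_ideal_def by (rule G.genideal_minimal[OF p.kernel_is_ideal])
  then have ker: "p x = \<zero>\<^bsub>L\<^esub>" if "x \<in> ?I" for x
    using that unfolding a_kernel_def' by blast
  obtain h where h: "h \<in> ring_hom (?G Quot ?I) L" "\<And>x. x \<in> carrier ?G \<Longrightarrow> h (?I +>\<^bsub>?G\<^esub> x) = p x"
    using quotient_hom_exists[OF free_DK_ideal_ideal[OF D K] L p ker] by metis
  show ?thesis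
  proof (rule that[of h])
    show "h \<in> ring_hom (free_DK_ring D K X) L"
      using h(1) by (simp add: free_DK_ring_def)
  qed (simp_all add: free_DK_const_def free_DK_var_def h(2) gen genx)
qed

lemma free_DK_var_closed:
  assumes "ring D" "K \<subseteq> carrier D" "x \<in> X"
  shows "free_DK_var D K X x \<in> carrier (free_DK_ring D K X)"
proof -
  have "free_ring_gen (Inr x) \<in> carrier (free_ring (carrier D <+> X))"
    using assms(3) by (intro free_ring_gen_closed) auto
  then show ?thesis
    using ring_hom_memE(1)[OF ideal.rcos_ring_hom[OF free_DK_ideal_ideal[OF assms(1,2)]]]
    by (simp add: free_DK_var_def free_DK_ring_def)
qed

lemma free_DK_ring_generated:
  assumes D: "ring D" and K: "K \<subseteq> carrier D" and T: "subring T (free_DK_ring D K X)"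
    and "\<And>a. a \<in> carrier D \<Longrightarrow> free_DK_const D K X a \<in> T"
    and "\<And>x. x \<in> X \<Longrightarrow> free_DK_var D K X x \<in> T"
  shows "T = carrier (free_DK_ring D K X)"
proof -
  let ?G = "free_ring (carrier D <+> X)" and ?I = "free_DK_ideal D K X"
  interpret G: ring ?G by (rule free_ring_ring)
  interpret I: ideal ?I ?G by (rule free_DK_ideal_ideal[OF D K])
  have Q: "ring (?G Quot ?I)"
    by (rule I.quotient_is_ring)
  interpret q: ring_hom_ring ?G "?G Quot ?I" "(+>\<^bsub>?G\<^esub>) ?I"
    by (rule I.rcos_ring_hom_ring)
  define T' where "T' = {g \<in> carrier ?G. ?I +>\<^bsub>?G\<^esub> g \<in> T}"
  note Tc = subringE[OF T[unfolded free_DK_ring_def]]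
  have memT': "g \<in> T' \<longleftrightarrow> g \<in> carrier ?G \<and> ?I +>\<^bsub>?G\<^esub> g \<in> T" for g
    by (simp add: T'_def)
  have "subring T' ?G"
  proof (rule G.subringI)
    show "T' \<subseteq> carrier ?G"
      by (simp add: T'_def)
    show "\<one>\<^bsub>?G\<^esub> \<in> T'"
      using Tc(3) unfolding memT' by (simp only: q.hom_one G.one_closed)
    show "\<ominus>\<^bsub>?G\<^esub> g \<in> T'" if "g \<in> T'" for g
      using that Tc(5) unfolding memT' by (simp only: q.hom_a_inv G.a_inv_closed)
    show "g \<otimes>\<^bsub>?G\<^esub> g' \<in> T'" "g \<oplus>\<^bsub>?G\<^esub> g' \<in> T'" if "g \<in> T'" "g' \<in> T'" for g g'
      using that Tc(6,7) unfolding memT'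
      by (simp_all only: q.hom_mult q.hom_add G.m_closed G.a_closed)
  qed
  then have "T' = carrier ?G"
  proof (rule free_ring_generated)
    fix s
    assume s: "s \<in> carrier D <+> X"
    then have "?I +>\<^bsub>?G\<^esub> free_ring_gen s \<in> T"
      using assms(4,5) unfolding free_DK_const_def free_DK_var_def by (cases s) auto
    then show "free_ring_gen s \<in> T'"
      using free_ring_gen_closed[OF s] memT' by blast
  qed
  then have "?I +>\<^bsub>?G\<^esub> g \<in> T" if "g \<in> carrier ?G" for g
    using that memT' by blast
  then have "carrier (?G Quot ?I) \<subseteq> T"
    by (auto simp only: FactRing_def A_RCOSETS_def' partial_object.simps)
  then show ?thesis
    using subringE(1)[OF T] unfolding free_DK_ring_def by blast
qed


text \<open>Locality does not mention the base ring, so only compatibility with the larger base is at stake: the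
  elements of \<open>D\<^sub>K\<langle>X\<rangle>\<close> that \<open>h\<close> sends into \<open>F0\<close> and on which \<open>\<alpha> \<circ> h\<close> equals \<open>g\<close> form a subring that
  contains the generators.\<close>

lemma local_homs_free_DK:
  assumes D: "ring D" and K: "K \<subseteq> carrier D" and F: "ring F" and E: "ring E"
    and \<alpha>: "(F0, \<alpha>) \<in> local_homs D F f E e"
    and h: "h \<in> ring_hom (free_DK_ring D K X) F"
      "\<And>a. a \<in> carrier D \<Longrightarrow> h (free_DK_const D K X a) = f a"
    and g: "g \<in> ring_hom (free_DK_ring D K X) E"
      "\<And>a. a \<in> carrier D \<Longrightarrow> g (free_DK_const D K X a) = e a"
    and var: "\<And>x. x \<in> X \<Longrightarrow> h (free_DK_var D K X x) \<in> F0"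
      "\<And>x. x \<in> X \<Longrightarrow> \<alpha> (h (free_DK_var D K X x)) = g (free_DK_var D K X x)"
  shows "(F0, \<alpha>) \<in> local_homs (free_DK_ring D K X) F h E g"
proof -
  let ?R = "free_DK_ring D K X"
  have R: "ring ?R"
    by (rule free_DK_ring_ring[OF D K])
  interpret R: ring ?R by (rule R)
  interpret h: ring_hom_ring ?R F h
    by (rule ring_hom_ringI2[OF R F h(1)])
  interpret g: ring_hom_ring ?R E g
    by (rule ring_hom_ringI2[OF R E g(1)])
  note \<alpha>' = \<alpha>[unfolded local_homs_iff]
  note F0 = subringE[OF conjunct1[OF \<alpha>']]
  have \<alpha>m: "\<alpha> (x \<otimes>\<^bsub>F\<^esub> y) = \<alpha> x \<otimes>\<^bsub>E\<^esub> \<alpha> y" "\<alpha> (x \<oplus>\<^bsub>F\<^esub> y) = \<alpha> x \<oplus>\<^bsub>E\<^esub> \<alpha> y"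
    if "x \<in> F0" "y \<in> F0" for x y
    using \<alpha>' that by auto
  have \<alpha>c: "\<alpha> x \<in> carrier E" if "x \<in> F0" for x
    using \<alpha>' that by blast
  have \<alpha>one: "\<alpha> \<one>\<^bsub>F\<^esub> = \<one>\<^bsub>E\<^esub>"
    using \<alpha>' by blast
  note \<alpha>neg = additive_on_subring(2)[OF F E conjunct1[OF \<alpha>'] \<alpha>c \<alpha>m(2)]
  define T where "T = {r \<in> carrier ?R. h r \<in> F0 \<and> \<alpha> (h r) = g r}"
  have "subring T ?R"
    by (rule R.subringI) (auto simp: T_def F0(3,5-7) \<alpha>m \<alpha>one \<alpha>neg)
  moreover have "free_DK_const D K X a \<in> T" if a: "a \<in> carrier D" for a
  proof -
    have "f a \<in> F0" "\<alpha> (f a) = e a"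
      using \<alpha>' a by blast+
    then show ?thesis
      using a h(2) g(2) ring_hom_memE(1)[OF free_DK_const_hom[OF D K]] by (simp add: T_def)
  qed
  moreover have "free_DK_var D K X x \<in> T" if x: "x \<in> X" for x
    using var free_DK_var_closed[OF D K] x by (simp add: T_def)
  ultimately have T: "T = carrier ?R"
    by (rule free_DK_ring_generated[OF D K])
  show ?thesis
    using \<alpha>' T unfolding local_homs_iff T_def by auto
qed


section \<open>Free fields lift along specializations\<close>

theorem theorem1p4:
  fixes D :: "'d ring" and K :: "'d set" and X :: "'x set"
    and U :: "'u ring" and u :: "(('d + 'x) list \<Rightarrow> int) set \<Rightarrow> 'u"
    and E :: "'e ring" and e :: "'d \<Rightarrow> 'e" and \<phi> :: "'u \<Rightarrow> 'e"
    and F :: "'f ring" and f :: "'d \<Rightarrow> 'f"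
    and \<sigma> :: "('f set \<times> ('f \<Rightarrow> 'e)) set" and F0 :: "'f set" and \<alpha> :: "'f \<Rightarrow> 'e"
  assumes "skew_field D" and "sub_skew_field K D" and "X \<noteq> {}"
    and "free_field D K X U u"
    and "over_field D E e" and "\<phi> \<in> free_field_embeddings D K X U u E e"
    and "over_field D F f"
    and "\<sigma> \<in> specializations D F f E e" and "(F0, \<alpha>) \<in> \<sigma>"
    and "\<forall>x\<in>X. {y \<in> F0. \<alpha> y = \<phi> (u (free_DK_var D K X x))} \<inter> centralizer F (f ` K) \<noteq> {}"
  shows "\<exists>\<psi>. \<psi> \<in> free_field_embeddings D K X U u F f"
proof -
  let ?R = "free_DK_ring D K X" and ?c = "free_DK_const D K X" and ?v = "free_DK_var D K X"
  have D: "ring D" and K: "K \<subseteq> carrier D"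
    using assms(1,2) skew_field_ring subringE(1) by (auto simp: sub_skew_field_def)
  have R: "ring ?R"
    by (rule free_DK_ring_ring[OF D K])
  have univ: "universal_field ?R U u"
    using assms(4) by (simp add: free_field_def universal_field_of_fractions_def)
  then have U: "ring U" and u: "u \<in> ring_hom ?R U"
    by (simp_all add: universal_field_def epic_field_def over_field_def over_ring_def)
  have E: "ring E" "\<one>\<^bsub>E\<^esub> \<noteq> \<zero>\<^bsub>E\<^esub>"
    using assms(5) by (auto simp: over_field_def over_ring_def skew_field_def)
  have F: "ring F" "skew_field F" "f \<in> ring_hom D F"
    using assms(7) by (auto simp: over_field_def over_ring_def)
  have \<phi>: "\<phi> \<in> ring_hom U E" "\<And>a. a \<in> carrier D \<Longrightarrow> \<phi> (u (?c a)) = e a"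
    using assms(6) by (auto simp: free_field_embeddings_def over_hom_def)
  have "\<sigma> \<subseteq> local_homs D F f E e"
    using in_quotient_imp_subset[OF equiv_spec_rel[OF F(1) E(2)]] assms(8)
    by (simp add: specializations_def)
  then have \<alpha>: "(F0, \<alpha>) \<in> local_homs D F f E e"
    using assms(9) by blast
  have "\<exists>y. y \<in> F0 \<and> \<alpha> y = \<phi> (u (?v x)) \<and> y \<in> centralizer F (f ` K)" if "x \<in> X" for x
    using assms(10) that by fast
  then obtain y where y: "\<And>x. x \<in> X \<Longrightarrow> y x \<in> F0" "\<And>x. x \<in> X \<Longrightarrow> \<alpha> (y x) = \<phi> (u (?v x))"
    "\<And>x. x \<in> X \<Longrightarrow> y x \<in> centralizer F (f ` K)"
    by metis
  obtain h where h: "h \<in> ring_hom ?R F" "\<And>a. a \<in> carrier D \<Longrightarrow> h (?c a) = f a"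
    "\<And>x. x \<in> X \<Longrightarrow> h (?v x) = y x"
    using free_DK_hom_exists[where y = y, OF D K F(1,3) y(3)] by metis
  have "(F0, \<alpha>) \<in> local_homs ?R F h E (\<phi> \<circ> u)"
  proof (rule local_homs_free_DK[OF D K F(1) E(1) \<alpha> h(1,2)])
    show "\<phi> \<circ> u \<in> ring_hom ?R E"
      by (rule ring_hom_trans[OF u \<phi>(1)])
  qed (use \<phi>(2) h(3) y(1,2) in simp_all)
  moreover have "over_field ?R F h"
    using F h(1) by (simp add: over_field_def over_ring_def)
  ultimately obtain \<psi> where \<psi>: "\<psi> \<in> over_hom ?R U u F h"
    using universal_field_lift_hom[OF R univ E \<phi>(1)] by blast
  have "\<psi> (u (?c a)) = f a" if a: "a \<in> carrier D" for a
    using \<psi> h(2)[OF a] ring_hom_memE(1)[OF free_DK_const_hom[OF D K, of X] a] by (auto simp: over_hom_def)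
  then have "\<psi> \<in> free_field_embeddings D K X U u F f"
    using \<psi> by (simp add: free_field_embeddings_def over_hom_def)
  then show ?thesis
    by blast
qed

end
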